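(* Let $H_1,\dots,H_N:\mathbb{R}\to\mathbb{R}$ be continuous, quasi-convex and coercive, and let $F:\mathbb{R}^N\to\mathbb{R}$ be continuous and non-increasing with respect to each of its variables. Then there exists $A_F\in\mathbb{R}$ such that, for every $T>0$, any continuous relaxed (viscosity) solution of $$u_t+H_i(u_x)=0 \ \text{ for } t\in(0,T),\ x\in J_i^*\ (i=1,\dots,N),\qquad u_t+F(u_x)=0\ \text{ for } t\in(0,T),\ x=0$$ is a flux-limited (viscosity) solution of $$u_t+H_i(u_x)=0 \ \text{ for } t\in(0,T),\ x\in J_i^*\ (i=1,\dots,N),\qquad u_t+F_A(u_x)=0\ \text{ for } t\in(0,T),\ x=0$$ with $A=A_F$.
   Context: Junction: $N\ge 1$; $J=\bigcup_{i=1}^N J_i$, where each branch $J_i$ is isometric to $[0,+\infty)$ and $J_i\cap J_j=\{0\}$ for $i\ne j$ ($0$ is the junction point); $J_i^*=J_i\setminus\{0\}$. For $T>0$, $J_T=(0,T)\times J$. For a function $u$ on $J$, $\partial_i u(x)$ is its derivative at $x\in J_i$ (in the coordinate of $[0,+\infty)$); $u_x(x)=\partial_i u(x)$ if $x\in J_i^*$ and $u_x(0)=(\partial_1u(0),\dots,\partial_Nu(0))$. Hamiltonians: $H_i$ is quasi-convex if its sub-level sets $\{H_i\le\lambda\}$ are convex; coercive means $H_i(p)\to+\infty$ as $|p|\to+\infty$. Then there is $p_i^0\in\mathbb{R}$ with $H_i$ nonincreasing on $(-\infty,p_i^0]$ and nondecreasing on $[p_i^0,+\infty)$. Set $H_i^-(q)=H_i(q)$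 if $q\le p_i^0$, $H_i^-(q)=H_i(p_i^0)$ if $q>p_i^0$. For $A\in\mathbb{R}\cup\{-\infty\}$ and $p=(p_1,\dots,p_N)$, $F_A(p)=\max\big(A,\max_{i=1,\dots,N}H_i^-(p_i)\big)$. Test functions: $C^1(J_T)$ is the set of $\varphi\in C(J_T)$ whose restriction to $(0,T)\times J_i$ is $C^1$ for every $i$. $\varphi$ touches $u$ from above (resp. below) at a point if $u-\varphi$ has a local maximum (resp. minimum) there. For a locally bounded $u$ on $[0,T)\times J$, $u^*$ and $u_*$ are its upper and lower semi-continuous envelopes. Relaxed solutions: $u$ is a relaxed sub-solution (resp. super-solution) of the problem with junction function $F$ on $(0,T)\times J$ if for every $\varphi\in C^1(J_T)$ touching $u^*$ from above (resp. $u_*$ from below) at $(t_0,x_0)\in J_T$: if $x_0\in J_i^*$, then $\varphi_t+H_i(\varphi_x)\le0$ (resp. $\ge0$) at $(t_0,x_0)$; if $x_0=0$, then either $\varphi_t+F(\varphi_x)\le0$ (resp. $\ge0$) or $\varphi_t+H_i(\partial_i\varphi)\le0$ (resp. $\ge0$) for some $i$, at $(t_0,0)$. A relaxed solution is both. Flux-limited solutions: $u$ is a flux-limited sub-solution (resp. super-solution) of the problem with junction function $F_A$ on $(0,T)\times J$ if for every such $\varphi$: if $x_0\in J_i^*$, $\varphi_t+H_i(\varphi_x)\le0$ (resp. $\ge0$) at $(t_0,x_0)$; if $x_0=0$, $\varphi_t+F_A(\varphi_x)\le0$ (resp. $\ge0$) at $(t_0,0)$. A flux-limited solution is both. *)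

theory Defs
  imports "HOL-Analysis.Analysis"
begin

section \<open>Hamiltonians\<close>

definition quasi_convex :: "(real \<Rightarrow> real) \<Rightarrow> bool"
  where "quasi_convex h \<longleftrightarrow> (\<forall>c. convex {p. h p \<le> c})"

definition coercive :: "(real \<Rightarrow> real) \<Rightarrow> bool"
  where "coercive h \<longleftrightarrow> filterlim h at_top at_infinity"

definition turning_point :: "(real \<Rightarrow> real) \<Rightarrow> real \<Rightarrow> bool"
  where "turning_point h p0 \<longleftrightarrow> antimono_on {..p0} h \<and> mono_on {p0..} h"

text \<open>A turning point need not be unique (\<open>h\<close> may be flat at its minimum), but
  \<open>nonincreasing_part\<close> does not depend on the one selected; see \<open>nonincreasing_part_eq\<close>.\<close>

definition nonincreasing_part :: "(real \<Rightarrow> real) \<Rightarrow> real \<Rightarrow> real"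
  where "nonincreasing_part h q =
    (let p0 = SOME p. turning_point h p in if q \<le> p0 then h q else h p0)"

lemma turning_point_exists:
  assumes cont: "continuous_on UNIV h" and qc: "quasi_convex h" and coer: "coercive h"
  shows "\<exists>p. turning_point h p"
proof -
  have "eventually (\<lambda>p. h p \<ge> h 0) at_infinity"
    using coer unfolding coercive_def filterlim_at_top by blast
  then obtain b where b: "\<And>p. norm p \<ge> b \<Longrightarrow> h p \<ge> h 0"
    unfolding eventually_at_infinity by blast
  define c where "c = max b 0"
  have "compact {-c..c}" "{-c..c} \<noteq> {}" by (auto simp: c_def)
  then obtain m where m: "m \<in> {-c..c}" "\<And>p. p \<in> {-c..c} \<Longrightarrow> h m \<le> h p"
    using continuous_attains_inf[of "{-c..c}" h] cont continuous_on_subset by blast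
  have min: "h m \<le> h p" for p
  proof (cases "p \<in> {-c..c}")
    case False
    then have "norm p \<ge> b" by (auto simp: c_def)
    then have "h 0 \<le> h p" by (rule b)
    moreover have "h m \<le> h 0" by (rule m(2)) (auto simp: c_def)
    ultimately show ?thesis by simp
  qed (use m in auto)
  have seg: "h y \<le> h x" if "y \<in> closed_segment m x" for x y
  proof -
    have "convex {p. h p \<le> h x}" using qc by (simp add: quasi_convex_def)
    moreover have "m \<in> {p. h p \<le> h x}" "x \<in> {p. h p \<le> h x}" using min by auto
    ultimately have "closed_segment m x \<subseteq> {p. h p \<le> h x}"
      by (meson closed_segment_subset)
    then show ?thesis using that by auto
  qed
  have "turning_point h m"
    unfolding turning_point_def
    by (auto intro!: monotone_onI seg simp: closed_segment_eq_real_ivl)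
  then show ?thesis by blast
qed

lemma nonincreasing_part_eq:
  assumes "turning_point h p0"
  shows "nonincreasing_part h q = (if q \<le> p0 then h q else h p0)"
proof -
  define p1 where "p1 = (SOME p. turning_point h p)"
  have p1: "turning_point h p1" unfolding p1_def using assms by (rule someI)
  have anti: "h y \<le> h x" if "turning_point h p" "x \<le> y" "y \<le> p" for p x y
    using that by (auto simp: turning_point_def monotone_on_def)
  have mono: "h x \<le> h y" if "turning_point h p" "p \<le> x" "x \<le> y" for p x y
    using that by (auto simp: turning_point_def monotone_on_def)
  show ?thesis
    unfolding nonincreasing_part_def p1_def[symmetric] Let_def
    using anti[OF p1] anti[OF assms] mono[OF p1] mono[OF assms]
    by (smt (verit))
qed


section \<open>The junction\<close>

text \<open>The junction with \<open>N = CARD('n)\<close> branches is realised as the union of the nonnegative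
  coordinate half-axes of \<open>real ^ 'n\<close>. The induced topology is that of the geodesic distance of
  the junction, and the coordinate of a point \<open>x\<close> of the branch \<open>i\<close> is \<open>x $ i\<close>.\<close>

definition branch_point :: "'n::finite \<Rightarrow> real \<Rightarrow> real ^ 'n"
  where "branch_point i r = r *\<^sub>R axis i 1"

definition branch :: "'n::finite \<Rightarrow> (real ^ 'n) set"
  where "branch i = branch_point i ` {0..}"

definition junction :: "(real ^ 'n::finite) set"
  where "junction = (\<Union>i. branch i)"

definition junction_T :: "real \<Rightarrow> (real \<times> (real ^ 'n::finite)) set"
  where "junction_T T = {0<..<T} \<times> junction"

definition time_deriv :: "(real \<times> (real ^ 'n::finite) \<Rightarrow> real) \<Rightarrow> real \<Rightarrow> real ^ 'n \<Rightarrow> real"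
  where "time_deriv \<phi> t x = vector_derivative (\<lambda>s. \<phi> (s, x)) (at t)"

text \<open>Derivative in the coordinate of the branch \<open>i\<close>; it is one-sided at the junction point.\<close>

definition branch_deriv ::
    "'n::finite \<Rightarrow> (real \<times> (real ^ 'n) \<Rightarrow> real) \<Rightarrow> real \<Rightarrow> real ^ 'n \<Rightarrow> real"
  where "branch_deriv i \<phi> t x =
    vector_derivative (\<lambda>r. \<phi> (t, branch_point i r)) (at (x $ i) within {0..})"

definition junction_gradient :: "(real \<times> (real ^ 'n::finite) \<Rightarrow> real) \<Rightarrow> real \<Rightarrow> real ^ 'n"
  where "junction_gradient \<phi> t = (\<chi> i. branch_deriv i \<phi> t 0)"


section \<open>Test functions and semi-continuous envelopes\<close>

text \<open>Used below only for sets on which the derivative within the set is unique.\<close>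

definition C1_on :: "'a::real_normed_vector set \<Rightarrow> ('a \<Rightarrow> 'b::real_normed_vector) \<Rightarrow> bool"
  where "C1_on S f \<longleftrightarrow> (\<exists>f' :: 'a \<Rightarrow> 'a \<Rightarrow>\<^sub>L 'b.
    (\<forall>z\<in>S. (f has_derivative blinfun_apply (f' z)) (at z within S)) \<and> continuous_on S f')"

definition test_functions :: "real \<Rightarrow> (real \<times> (real ^ 'n::finite) \<Rightarrow> real) set"
  where "test_functions T = {\<phi>. continuous_on (junction_T T) \<phi> \<and>
    (\<forall>i. C1_on ({0<..<T} \<times> {0..}) (\<lambda>(t, r). \<phi> (t, branch_point i r)))}"

definition locally_bounded_on ::
    "'a::metric_space set \<Rightarrow> ('a \<Rightarrow> 'b::metric_space) \<Rightarrow> bool"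
  where "locally_bounded_on D u \<longleftrightarrow> (\<forall>z\<in>D. \<exists>e>0. bounded (u ` (D \<inter> ball z e)))"

text \<open>The limits are taken over points of \<open>D\<close> near \<open>z\<close>, the point \<open>z\<close> itself included. The
  values are finite at the points of \<open>D\<close> when \<open>u\<close> is locally bounded on \<open>D\<close>.\<close>

definition upper_envelope :: "'a::topological_space set \<Rightarrow> ('a \<Rightarrow> real) \<Rightarrow> 'a \<Rightarrow> real"
  where "upper_envelope D u z =
    real_of_ereal (Limsup (inf (nhds z) (principal D)) (\<lambda>w. ereal (u w)))"

definition lower_envelope :: "'a::topological_space set \<Rightarrow> ('a \<Rightarrow> real) \<Rightarrow> 'a \<Rightarrow> real"
  where "lower_envelope D u z =
    real_of_ereal (Liminf (inf (nhds z) (principal D)) (\<lambda>w. ereal (u w)))"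

definition touches_from_above ::
    "'a::topological_space set \<Rightarrow> ('a \<Rightarrow> real) \<Rightarrow> ('a \<Rightarrow> real) \<Rightarrow> 'a \<Rightarrow> bool"
  where "touches_from_above D \<phi> v z \<longleftrightarrow> (\<forall>\<^sub>F w in at z within D. v w - \<phi> w \<le> v z - \<phi> z)"

definition touches_from_below ::
    "'a::topological_space set \<Rightarrow> ('a \<Rightarrow> real) \<Rightarrow> ('a \<Rightarrow> real) \<Rightarrow> 'a \<Rightarrow> bool"
  where "touches_from_below D \<phi> v z \<longleftrightarrow> (\<forall>\<^sub>F w in at z within D. v w - \<phi> w \<ge> v z - \<phi> z)"


section \<open>Relaxed solutions\<close>

definition relaxed_subsolution ::
    "('n::finite \<Rightarrow> real \<Rightarrow> real) \<Rightarrow> (real ^ 'n \<Rightarrow> real) \<Rightarrow> real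
      \<Rightarrow> (real \<times> (real ^ 'n) \<Rightarrow> real) \<Rightarrow> bool"
  where "relaxed_subsolution H F T u \<longleftrightarrow>
    locally_bounded_on ({0..<T} \<times> junction) u \<and>
    (\<forall>\<phi>\<in>test_functions T. \<forall>(t, x)\<in>junction_T T.
      touches_from_above (junction_T T) \<phi> (upper_envelope ({0..<T} \<times> junction) u) (t, x) \<longrightarrow>
        (\<forall>i. x \<in> branch i - {0} \<longrightarrow> time_deriv \<phi> t x + H i (branch_deriv i \<phi> t x) \<le> 0) \<and>
        (x = 0 \<longrightarrow> time_deriv \<phi> t 0 + F (junction_gradient \<phi> t) \<le> 0 \<or>
          (\<exists>i. time_deriv \<phi> t 0 + H i (branch_deriv i \<phi> t 0) \<le> 0)))"

definition relaxed_supersolution ::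
    "('n::finite \<Rightarrow> real \<Rightarrow> real) \<Rightarrow> (real ^ 'n \<Rightarrow> real) \<Rightarrow> real
      \<Rightarrow> (real \<times> (real ^ 'n) \<Rightarrow> real) \<Rightarrow> bool"
  where "relaxed_supersolution H F T u \<longleftrightarrow>
    locally_bounded_on ({0..<T} \<times> junction) u \<and>
    (\<forall>\<phi>\<in>test_functions T. \<forall>(t, x)\<in>junction_T T.
      touches_from_below (junction_T T) \<phi> (lower_envelope ({0..<T} \<times> junction) u) (t, x) \<longrightarrow>
        (\<forall>i. x \<in> branch i - {0} \<longrightarrow> time_deriv \<phi> t x + H i (branch_deriv i \<phi> t x) \<ge> 0) \<and>
        (x = 0 \<longrightarrow> time_deriv \<phi> t 0 + F (junction_gradient \<phi> t) \<ge> 0 \<or>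
          (\<exists>i. time_deriv \<phi> t 0 + H i (branch_deriv i \<phi> t 0) \<ge> 0)))"

definition relaxed_solution ::
    "('n::finite \<Rightarrow> real \<Rightarrow> real) \<Rightarrow> (real ^ 'n \<Rightarrow> real) \<Rightarrow> real
      \<Rightarrow> (real \<times> (real ^ 'n) \<Rightarrow> real) \<Rightarrow> bool"
  where "relaxed_solution H F T u \<longleftrightarrow>
    relaxed_subsolution H F T u \<and> relaxed_supersolution H F T u"


section \<open>Flux-limited solutions\<close>

text \<open>The flux limiter \<open>A\<close> is allowed to be \<open>-\<infinity>\<close>; the value of \<open>flux_limiter\<close> is then still
  finite, whereas \<open>A = \<infinity>\<close> is meaningless.\<close>

definition flux_limiter :: "('n::finite \<Rightarrow> real \<Rightarrow> real) \<Rightarrow> ereal \<Rightarrow> real ^ 'n \<Rightarrow> real"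
  where "flux_limiter H A p =
    real_of_ereal (max A (ereal (MAX i. nonincreasing_part (H i) (p $ i))))"

definition flux_limited_subsolution ::
    "('n::finite \<Rightarrow> real \<Rightarrow> real) \<Rightarrow> ereal \<Rightarrow> real
      \<Rightarrow> (real \<times> (real ^ 'n) \<Rightarrow> real) \<Rightarrow> bool"
  where "flux_limited_subsolution H A T u \<longleftrightarrow>
    locally_bounded_on ({0..<T} \<times> junction) u \<and>
    (\<forall>\<phi>\<in>test_functions T. \<forall>(t, x)\<in>junction_T T.
      touches_from_above (junction_T T) \<phi> (upper_envelope ({0..<T} \<times> junction) u) (t, x) \<longrightarrow>
        (\<forall>i. x \<in> branch i - {0} \<longrightarrow> time_deriv \<phi> t x + H i (branch_deriv i \<phi> t x) \<le> 0) \<and>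
        (x = 0 \<longrightarrow> time_deriv \<phi> t 0 + flux_limiter H A (junction_gradient \<phi> t) \<le> 0))"

definition flux_limited_supersolution ::
    "('n::finite \<Rightarrow> real \<Rightarrow> real) \<Rightarrow> ereal \<Rightarrow> real
      \<Rightarrow> (real \<times> (real ^ 'n) \<Rightarrow> real) \<Rightarrow> bool"
  where "flux_limited_supersolution H A T u \<longleftrightarrow>
    locally_bounded_on ({0..<T} \<times> junction) u \<and>
    (\<forall>\<phi>\<in>test_functions T. \<forall>(t, x)\<in>junction_T T.
      touches_from_below (junction_T T) \<phi> (lower_envelope ({0..<T} \<times> junction) u) (t, x) \<longrightarrow>
        (\<forall>i. x \<in> branch i - {0} \<longrightarrow> time_deriv \<phi> t x + H i (branch_deriv i \<phi> t x) \<ge> 0) \<and>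
        (x = 0 \<longrightarrow> time_deriv \<phi> t 0 + flux_limiter H A (junction_gradient \<phi> t) \<ge> 0))"

definition flux_limited_solution ::
    "('n::finite \<Rightarrow> real \<Rightarrow> real) \<Rightarrow> ereal \<Rightarrow> real
      \<Rightarrow> (real \<times> (real ^ 'n) \<Rightarrow> real) \<Rightarrow> bool"
  where "flux_limited_solution H A T u \<longleftrightarrow>
    flux_limited_subsolution H A T u \<and> flux_limited_supersolution H A T u"

end

theory Submission imports Defs begin

text \<open>At points of the open branches the two notions of solution ask for the same inequalities, so
  everything happens at the junction point. Let a test function \<open>\<phi>\<close> touch \<open>u\<close> at \<open>(t\<^sub>0, 0)\<close>, put
  \<open>\<lambda> = - \<phi>\<^sub>t\<close>, let \<open>p\<close> be the gradient of \<open>\<phi>\<close> there, and let \<open>\<pi>\<^sub>i\<close> be a turning point of \<open>H\<^sub>i\<close>.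
  The relaxed condition speaks only of the slopes of a function that touches \<open>u\<close>. Hence the idea is to
  exchange the slopes \<open>p\<close> of \<open>\<phi>\<close> for better chosen slopes \<open>q\<close>.

  This exchange is possible because the equation holds inside the branches. If \<open>\<phi>\<close> touches from
  below and \<open>H\<^sub>i < \<lambda>\<close> on the whole interval \<open>[p\<^sub>i, q\<^sub>i]\<close>, then no function whose derivatives are close to
  \<open>- \<lambda>\<close> and to a point of that interval can touch \<open>u\<close> from below inside the branch; therefore the
  slope on that branch can be raised from \<open>p\<^sub>i\<close> to \<open>q\<^sub>i\<close> (\<open>raise_slope\<close>, \<open>junction_inequality\<close>). Lowering a slope is
  always possible. The change of sign \<open>u \<mapsto> - u\<close>
  gives the mirrored statement for touching from above.

  The flux limiter is the infimum \<open>A\<close> of the levels \<open>a\<close> for which some \<open>q\<close> with \<open>q\<^sub>i \<ge> \<pi>\<^sub>i\<close> satisfies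
  \<open>H\<^sub>i(q\<^sub>i) < a\<close> for all \<open>i\<close> and \<open>F(q) < a\<close>.

  \<^item> Super-solutions. If the flux-limited inequality fails, then \<open>\<lambda> > A\<close> and \<open>\<lambda> > H\<^sub>i\<^sup>-(p\<^sub>i)\<close> for all \<open>i\<close>.
    Take \<open>q\<close> as above for the level \<open>\<lambda>\<close>. By quasi-convexity \<open>H\<^sub>i < \<lambda>\<close> on \<open>[p\<^sub>i, q\<^sub>i]\<close> whenever
    \<open>p\<^sub>i < q\<^sub>i\<close>, so the slopes can be exchanged for \<open>q\<close>, and all alternatives of the relaxed condition fail.

  \<^item> Sub-solutions, when \<open>\<lambda> < H\<^sub>i\<^sup>-(p\<^sub>i)\<close> for some \<open>i\<close>. Then \<open>H\<^sub>i > \<lambda>\<close> on the whole ray of slopes below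
    \<open>p\<^sub>i\<close>. A barrier \<open>\<epsilon> / r\<close> added to \<open>\<phi>\<close> pushes the touching point into the branch \<open>i\<close> and only
    makes the slope smaller, which contradicts the equation on the branch
    (\<open>touched_by_large_slope\<close>). The continuity of \<open>u\<close> at the junction point along the branch is essential here.

  \<^item> Sub-solutions, when \<open>\<lambda> < A\<close> and \<open>\<lambda> \<ge> H\<^sub>i\<^sup>-(p\<^sub>i)\<close> for all \<open>i\<close>. Then \<open>\<lambda> \<ge> min H\<^sub>i\<close>. Take \<open>\<lambda> < \<lambda>' < A\<close>
    and \<open>q\<^sub>i \<ge> \<pi>\<^sub>i\<close> with \<open>\<lambda> < H\<^sub>i(q\<^sub>i) < \<lambda>'\<close>. Since \<open>\<lambda>' < A\<close>, these \<open>q\<close> satisfy \<open>F(q) \<ge> \<lambda>' > \<lambda>\<close>; since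
    \<open>H\<^sub>i > \<lambda>\<close> to the right of \<open>q\<^sub>i\<close>, the slopes can be exchanged for \<open>q\<close>, and again all alternatives of the
    relaxed condition fail.\<close>


section \<open>Touching paraboloids on a half-plane\<close>

definition paraboloid :: "real \<Rightarrow> real \<Rightarrow> real \<Rightarrow> real \<Rightarrow> real \<times> real \<Rightarrow> real"
  where "paraboloid t0 a b c z = a * snd z + b * (snd z)\<^sup>2 + c * (fst z - t0)\<^sup>2"

text \<open>Thus \<open>(\<tau>, p)\<close> is a viscosity subgradient of \<open>w\<close> at the interior point \<open>z\<close> of a branch, but tested with
  few functions only. They suffice because \<open>w\<close> will be the difference of a solution and a test function,
  and the perturbations of that test function that the barriers below call for all have this form.\<close>

definition lower_touching :: "(real \<times> real \<Rightarrow> real) \<Rightarrow> real \<Rightarrow> real \<times> real \<Rightarrow> real \<Rightarrow> real \<Rightarrow> bool"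
  where "lower_touching w t0 z \<tau> p \<longleftrightarrow>
    (\<exists>a b c. \<tau> = 2 * c * (fst z - t0) \<and> p = a + 2 * b * snd z \<and>
      (\<forall>\<^sub>F y in nhds z. w z - paraboloid t0 a b c z \<le> w y - paraboloid t0 a b c y))"

lemma eventually_nhds_box:
  fixes t r :: real
  assumes "e > 0" and "\<And>s q. \<bar>s - t\<bar> < e \<Longrightarrow> \<bar>q - r\<bar> < e \<Longrightarrow> P (s, q)"
  shows "\<forall>\<^sub>F y in nhds (t, r). P y"
proof -
  have "{t - e<..<t + e} \<times> {r - e<..<r + e} \<in> {S. open S}"
    by (auto intro: open_Times)
  moreover have "P y" if "y \<in> {t - e<..<t + e} \<times> {r - e<..<r + e}" for y
    using that assms(2)[of "fst y" "snd y"] by (auto simp: abs_less_iff)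
  ultimately show ?thesis
    using assms(1) unfolding eventually_nhds
    by (intro exI[of _ "{t - e<..<t + e} \<times> {r - e<..<r + e}"]) auto
qed

text \<open>The slope of a barrier \<open>s r - k (t - t\<^sub>0)\<^sup>2\<close> can be raised a little by the minimum principle. The
  function \<open>(s + d/2) r - d r\<^sup>2 / (2 \<rho>) - (k + 1) (t - t\<^sub>0)\<^sup>2\<close> has all its slopes within \<open>d/2\<close> of \<open>s\<close> for
  \<open>r\<close> in \<open>[0, \<rho>]\<close>, so it cannot touch \<open>w\<close> inside the box. On the edges \<open>r = 0\<close> and \<open>r = \<rho>\<close> its excess over
  the old barrier, \<open>d r (1 - r / \<rho>) / 2 - (t - t\<^sub>0)\<^sup>2\<close>, is at most \<open>0\<close>; on the edges \<open>\<bar>t - t\<^sub>0\<bar> = \<delta>\<close> the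
  time term wins when \<open>\<rho>\<close> is small compared with \<open>\<delta>\<^sup>2\<close>. Hence it stays below \<open>w\<close> in the box.\<close>

lemma raise_slope_step:
  assumes d: "d > 0" and cont: "continuous_on ({t0 - d..t0 + d} \<times> {0..d}) w"
    and untouched: "\<And>t r \<tau> p. \<lbrakk>\<bar>t - t0\<bar> < d; 0 < r; r < d; \<bar>\<tau>\<bar> < d; - d < p; p < S + d\<rbrakk>
      \<Longrightarrow> \<not> lower_touching w t0 (t, r) \<tau> p"
    and s: "0 \<le> s" "s \<le> S" and k: "0 \<le> k" and e: "0 < e" "e \<le> d"
    and below: "\<And>t r. \<lbrakk>\<bar>t - t0\<bar> \<le> e; 0 \<le> r; r \<le> e\<rbrakk> \<Longrightarrow> s * r - k * (t - t0)\<^sup>2 \<le> w (t, r)"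
  shows "\<exists>e'>0. e' \<le> d \<and> (\<forall>t r. \<bar>t - t0\<bar> \<le> e' \<longrightarrow> 0 \<le> r \<longrightarrow> r \<le> e' \<longrightarrow>
    (s + d / 4) * r - (k + 1) * (t - t0)\<^sup>2 \<le> w (t, r))"
proof -
  define \<delta> where "\<delta> = min e (d / (4 * (k + 1)))"
  define \<rho> where "\<rho> = min e (2 * \<delta>\<^sup>2 / d)"
  have \<delta>: "\<delta> > 0" "\<delta> \<le> e" "2 * (k + 1) * \<delta> \<le> d / 2"
  proof -
    show "\<delta> > 0" "\<delta> \<le> e" using d e k by (auto simp: \<delta>_def)
    have "\<delta> \<le> d / (4 * (k + 1))" by (simp add: \<delta>_def)
    then show "2 * (k + 1) * \<delta> \<le> d / 2" using k by (simp add: field_simps)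
  qed
  have \<rho>: "\<rho> > 0" "\<rho> \<le> e" "d / 2 * \<rho> \<le> \<delta>\<^sup>2"
  proof -
    show "\<rho> > 0" "\<rho> \<le> e" using d e \<delta> by (auto simp: \<rho>_def)
    have "\<rho> \<le> 2 * \<delta>\<^sup>2 / d" by (simp add: \<rho>_def)
    then show "d / 2 * \<rho> \<le> \<delta>\<^sup>2" using d by (simp add: field_simps)
  qed
  define a b c where abc: "a = s + d / 2" "b = - (d / (2 * \<rho>))" "c = - (k + 1)"
  define f where "f y = w y - paraboloid t0 a b c y" for y
  define B where "B = {t0 - \<delta>..t0 + \<delta>} \<times> {0..\<rho>}"
  have f_eq: "f (t, r) = (w (t, r) - (s * r - k * (t - t0)\<^sup>2)) + (t - t0)\<^sup>2 - d / 2 * r * (1 - r / \<rho>)" for t r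
    using \<rho> by (simp add: f_def paraboloid_def abc field_simps power2_eq_square)
  have "B \<subseteq> {t0 - d..t0 + d} \<times> {0..d}" using \<delta> \<rho> e by (auto simp: B_def)
  then have "continuous_on B w" by (rule continuous_on_subset[OF cont])
  then have "continuous_on B f"
    unfolding f_def paraboloid_def by (intro continuous_intros)
  moreover have "compact B" "B \<noteq> {}" using \<delta> \<rho> by (auto simp: B_def intro!: compact_Times)
  ultimately obtain m where m: "m \<in> B" "\<And>y. y \<in> B \<Longrightarrow> f m \<le> f y"
    using continuous_attains_inf[of B f] by blast
  obtain t1 r1 where m_eq: "m = (t1, r1)" by force
  have m1: "\<bar>t1 - t0\<bar> \<le> \<delta>" "0 \<le> r1" "r1 \<le> \<rho>" using m(1) by (auto simp: m_eq B_def)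
  have base: "s * r1 - k * (t1 - t0)\<^sup>2 \<le> w (t1, r1)" using below m1 \<delta> \<rho> by simp
  \<comment> \<open>A negative minimum would be interior, by the signs on the edges, hence a touching point.\<close>
  have "0 \<le> f m"
  proof (rule ccontr)
    assume "\<not> 0 \<le> f m"
    then have neg: "(t1 - t0)\<^sup>2 < d / 2 * r1 * (1 - r1 / \<rho>)"
      using base unfolding m_eq f_eq by linarith
    have r1: "0 < r1" "r1 < \<rho>"
    proof -
      show "0 < r1" using neg m1(2) by (cases "r1 = 0") (auto simp: not_less)
      show "r1 < \<rho>" using neg m1(3) \<rho>(1) by (cases "r1 = \<rho>") (auto simp: not_less)
    qed
    have "d / 2 * r1 * (1 - r1 / \<rho>) \<le> d / 2 * r1 * 1"
      using d r1 \<rho> by (intro mult_left_mono) auto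
    also have "\<dots> \<le> d / 2 * \<rho>" using d r1 by simp
    finally have "(t1 - t0)\<^sup>2 < \<delta>\<^sup>2" using neg \<rho>(3) by linarith
    then have t1: "\<bar>t1 - t0\<bar> < \<delta>" using \<delta>(1) by (metis abs_le_square_iff abs_of_pos linorder_not_less)
    define \<epsilon> where "\<epsilon> = min (\<delta> - \<bar>t1 - t0\<bar>) (min r1 (\<rho> - r1))"
    have "\<forall>\<^sub>F y in nhds (t1, r1). f m \<le> f y"
    proof (rule eventually_nhds_box)
      show "\<epsilon> > 0" using t1 r1 by (simp add: \<epsilon>_def)
      show "f m \<le> f (t, r)" if "\<bar>t - t1\<bar> < \<epsilon>" "\<bar>r - r1\<bar> < \<epsilon>" for t r
        using that by (intro m(2)) (auto simp: B_def \<epsilon>_def)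
    qed
    then have "lower_touching w t0 (t1, r1) (2 * c * (t1 - t0)) (a + 2 * b * r1)"
      unfolding lower_touching_def f_def m_eq by (intro exI[of _ a] exI[of _ b] exI[of _ c]) simp
    moreover have "\<bar>2 * c * (t1 - t0)\<bar> < d"
    proof -
      have "\<bar>2 * c * (t1 - t0)\<bar> = 2 * (k + 1) * \<bar>t1 - t0\<bar>" using k by (simp add: abs_mult abc)
      also have "\<dots> \<le> 2 * (k + 1) * \<delta>" using m1 k by (intro mult_left_mono) auto
      finally show ?thesis using \<delta>(3) d by linarith
    qed
    moreover have "- d < a + 2 * b * r1" "a + 2 * b * r1 < S + d"
    proof -
      have "a + 2 * b * r1 = s + d / 2 - d * (r1 / \<rho>)" by (simp add: abc)
      moreover have "0 \<le> d * (r1 / \<rho>)" "d * (r1 / \<rho>) \<le> d * 1"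
        using d r1 by (simp, intro mult_left_mono) auto
      ultimately show "- d < a + 2 * b * r1" "a + 2 * b * r1 < S + d" using s d by linarith+
    qed
    ultimately show False using untouched t1 r1 \<delta> \<rho> e by (meson less_le_trans order_trans)
  qed
  then have f_nonneg: "0 \<le> f y" if "y \<in> B" for y using m(2)[OF that] by linarith
  \<comment> \<open>For \<open>r \<le> \<rho> / 2\<close> the quadratic term costs at most half of the added slope \<open>d / 2\<close>.\<close>
  define e' where "e' = min \<delta> (\<rho> / 2)"
  have "(s + d / 4) * r - (k + 1) * (t - t0)\<^sup>2 \<le> w (t, r)"
    if "\<bar>t - t0\<bar> \<le> e'" "0 \<le> r" "r \<le> e'" for t r
  proof -
    have "(t, r) \<in> B" using that \<delta> \<rho> by (auto simp: B_def e'_def)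
    then have "0 \<le> f (t, r)" by (rule f_nonneg)
    moreover have "d / 2 * r * (1 / 2) \<le> d / 2 * r * (1 - r / \<rho>)"
      using that d \<rho> by (intro mult_left_mono) (auto simp: e'_def field_simps)
    moreover have "(s + d / 4) * r = s * r + d / 2 * r * (1 / 2)"
      "(k + 1) * (t - t0)\<^sup>2 = k * (t - t0)\<^sup>2 + (t - t0)\<^sup>2"
      by (simp_all add: algebra_simps)
    ultimately show ?thesis unfolding f_eq by linarith
  qed
  moreover have "e' > 0" "e' \<le> d" using \<delta> \<rho> e by (auto simp: e'_def)
  ultimately show ?thesis by blast
qed

text \<open>The increment \<open>d / 4\<close> of a single step depends only on the margin by which touching slopes are
  excluded, so finitely many steps reach \<open>S\<close>. The neighbourhood shrinks and the coefficient of the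
  time penalty grows with every step, which does no harm: the penalty has no first-order
  part at \<open>t\<^sub>0\<close>.\<close>

lemma raise_slope:
  assumes d: "d > 0" and cont: "continuous_on ({t0 - d..t0 + d} \<times> {0..d}) w"
    and untouched: "\<And>t r \<tau> p. \<lbrakk>\<bar>t - t0\<bar> < d; 0 < r; r < d; \<bar>\<tau>\<bar> < d; - d < p; p < S + d\<rbrakk>
      \<Longrightarrow> \<not> lower_touching w t0 (t, r) \<tau> p"
    and nonneg: "\<And>t r. \<lbrakk>\<bar>t - t0\<bar> \<le> d; 0 \<le> r; r \<le> d\<rbrakk> \<Longrightarrow> 0 \<le> w (t, r)"
    and S: "0 \<le> S"
  shows "\<exists>k\<ge>0. \<exists>e>0. \<forall>t r. \<bar>t - t0\<bar> \<le> e \<longrightarrow> 0 \<le> r \<longrightarrow> r \<le> e \<longrightarrow>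
    S * r - k * (t - t0)\<^sup>2 \<le> w (t, r)"
proof -
  define s where "s n = min S (real n * (d / 4))" for n
  have s: "0 \<le> s n" "s n \<le> S" "s (Suc n) \<le> s n + d / 4" for n
    using d S by (auto simp: s_def field_simps min_def)
  have steps: "\<exists>e>0. e \<le> d \<and> (\<forall>t r. \<bar>t - t0\<bar> \<le> e \<longrightarrow> 0 \<le> r \<longrightarrow> r \<le> e \<longrightarrow>
    s n * r - real n * (t - t0)\<^sup>2 \<le> w (t, r))" for n
  proof (induction n)
    case 0
    then show ?case using d S nonneg by (auto simp: s_def intro!: exI[of _ d])
  next
    case (Suc n)
    then obtain e where e: "0 < e" "e \<le> d"
      and below: "\<And>t r. \<lbrakk>\<bar>t - t0\<bar> \<le> e; 0 \<le> r; r \<le> e\<rbrakk> \<Longrightarrow> s n * r - real n * (t - t0)\<^sup>2 \<le> w (t, r)"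
      by blast
    obtain e' where e': "e' > 0" "e' \<le> d"
      and below': "\<And>t r. \<lbrakk>\<bar>t - t0\<bar> \<le> e'; 0 \<le> r; r \<le> e'\<rbrakk> \<Longrightarrow>
        (s n + d / 4) * r - (real n + 1) * (t - t0)\<^sup>2 \<le> w (t, r)"
      using raise_slope_step[OF d cont untouched s(1,2) of_nat_0_le_iff e below] by blast
    have "s (Suc n) * r - real (Suc n) * (t - t0)\<^sup>2 \<le> w (t, r)"
      if "\<bar>t - t0\<bar> \<le> e'" "0 \<le> r" "r \<le> e'" for t r
    proof -
      have "s (Suc n) * r \<le> (s n + d / 4) * r" using s(3) that by (intro mult_right_mono) auto
      then show ?thesis using below'[OF that] by (simp add: algebra_simps)
    qed
    then show ?case using e' by blast
  qed
  obtain n where "S < real n * (d / 4)" using d reals_Archimedean3[of "d / 4"] by auto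
  then have "s n = S" by (simp add: s_def)
  then show ?thesis using steps[of n] of_nat_0_le_iff by metis
qed

text \<open>Minimise \<open>w + (t - t\<^sub>0)\<^sup>2 + r\<^sup>2 + \<epsilon> / r\<close> over a box. The singular term keeps the minimum away from \<open>r = 0\<close>;
  since \<open>w\<close> tends to \<open>0\<close> along \<open>t = t\<^sub>0\<close>, for small \<open>\<epsilon>\<close> the quadratic terms keep it away from the other
  edges. At the minimum \<open>w\<close> is touched from below with space slope \<open>\<epsilon> / r\<^sup>2 - 2 r\<close>, of which nothing is
  known but that it is hardly negative: this is why no upper bound on \<open>p\<close> is claimed.\<close>

lemma touched_by_large_slope:
  assumes d: "d > 0" and cont: "continuous_on ({t0 - d..t0 + d} \<times> {0..d}) w"
    and nonneg: "\<And>t r. \<lbrakk>\<bar>t - t0\<bar> \<le> d; 0 \<le> r; r \<le> d\<rbrakk> \<Longrightarrow> 0 \<le> w (t, r)"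
    and zero: "w (t0, 0) = 0"
  shows "\<exists>t r \<tau> p. \<bar>t - t0\<bar> < d \<and> 0 < r \<and> r < d \<and> \<bar>\<tau>\<bar> < d \<and> - d < p \<and>
    lower_touching w t0 (t, r) \<tau> p"
proof -
  define \<delta> where "\<delta> = d / 4"
  have \<delta>: "\<delta> > 0" "\<delta> < d" "2 * \<delta> < d" using d by (auto simp: \<delta>_def)
  obtain x where x: "0 < x" "x < \<delta>" "w (t0, x) + x\<^sup>2 < \<delta>\<^sup>2 / 2"
  proof -
    have "continuous_on {0..d} (\<lambda>r. w (t0, r) + r\<^sup>2)"
      using d by (intro continuous_intros continuous_on_compose2[OF cont]) auto
    then have "((\<lambda>r. w (t0, r) + r\<^sup>2) \<longlongrightarrow> w (t0, 0) + 0\<^sup>2) (at 0 within {0..d})"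
      using d unfolding continuous_on_def by force
    then have "\<forall>\<^sub>F r in at 0 within {0..d}. w (t0, r) + r\<^sup>2 < \<delta>\<^sup>2 / 2"
      using \<delta> zero by (intro order_tendstoD) auto
    then have "\<forall>\<^sub>F r in at_right 0. w (t0, r) + r\<^sup>2 < \<delta>\<^sup>2 / 2"
      using d by (simp add: at_within_Icc_at_right)
    moreover have "\<forall>\<^sub>F r in at_right 0. r < \<delta>" "\<forall>\<^sub>F r in at_right (0::real). 0 < r"
      using \<delta> by (auto simp: eventually_at_right_less eventually_at_right_field intro: exI[of _ \<delta>])
    ultimately have "\<forall>\<^sub>F r in at_right 0. 0 < r \<and> r < \<delta> \<and> w (t0, r) + r\<^sup>2 < \<delta>\<^sup>2 / 2"
      by eventually_elim auto
    then show ?thesis using that eventually_happens'[OF trivial_limit_at_right_real] by blast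
  qed
  \<comment> \<open>Then \<open>\<epsilon> / x = \<delta>\<^sup>2 / 4\<close>, so the functional is below \<open>\<delta>\<^sup>2\<close> at \<open>(t\<^sub>0, x)\<close>; and \<open>\<epsilon> / r = \<delta>\<^sup>2\<close> for \<open>r = x / 4\<close>,
    the inner edge of the box.\<close>
  define \<epsilon> where "\<epsilon> = x * \<delta>\<^sup>2 / 4"
  have \<epsilon>: "\<epsilon> > 0" using x \<delta> by (simp add: \<epsilon>_def)
  define f where "f y = w y + (fst y - t0)\<^sup>2 + (snd y)\<^sup>2 + \<epsilon> / snd y" for y :: "real \<times> real"
  define B where "B = {t0 - \<delta>..t0 + \<delta>} \<times> {x / 4..\<delta>}"
  have "B \<subseteq> {t0 - d..t0 + d} \<times> {0..d}" using \<delta> x(1,2) by (auto simp: B_def)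
  then have "continuous_on B w" by (rule continuous_on_subset[OF cont])
  then have "continuous_on B f"
    unfolding f_def using x(1) by (intro continuous_intros) (auto simp: B_def)
  moreover have "compact B" "B \<noteq> {}" using \<delta>(1,2) x(1,2) by (auto simp: B_def intro!: compact_Times)
  ultimately obtain m where m: "m \<in> B" "\<And>y. y \<in> B \<Longrightarrow> f m \<le> f y"
    using continuous_attains_inf[of B f] by blast
  obtain t r where m_eq: "m = (t, r)" by force
  have tr: "\<bar>t - t0\<bar> \<le> \<delta>" "x / 4 \<le> r" "r \<le> \<delta>" using m(1) by (auto simp: m_eq B_def)
  have r_pos: "r > 0" using tr x by linarith
  have "f m \<le> f (t0, x)" using x(1,2) \<delta>(1) by (intro m(2)) (auto simp: B_def)
  also have "\<dots> < \<delta>\<^sup>2"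
  proof -
    have "\<epsilon> / x = \<delta>\<^sup>2 / 4" using x(1) by (simp add: \<epsilon>_def)
    then have "f (t0, x) = w (t0, x) + x\<^sup>2 + \<delta>\<^sup>2 / 4" by (simp only: f_def fst_conv snd_conv) simp
    then show ?thesis using x(3) zero_less_power[OF \<delta>(1), of 2] by linarith
  qed
  finally have "f m < \<delta>\<^sup>2" .
  moreover have "0 \<le> w (t, r)" using tr r_pos \<delta> by (intro nonneg) auto
  moreover have "\<epsilon> / r \<ge> 0" using \<epsilon> r_pos by simp
  ultimately have small: "(t - t0)\<^sup>2 < \<delta>\<^sup>2" "r\<^sup>2 < \<delta>\<^sup>2" "\<epsilon> / r < \<delta>\<^sup>2"
    unfolding m_eq f_def fst_conv snd_conv
    using zero_le_power2[of "t - t0"] zero_le_power2[of r] by linarith+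
  have inner: "\<bar>t - t0\<bar> < \<delta>" "r < \<delta>" "x / 4 < r"
  proof -
    show "\<bar>t - t0\<bar> < \<delta>" using small(1) \<delta> by (metis abs_le_square_iff abs_of_pos linorder_not_less)
    show "r < \<delta>" using small(2) \<delta> by (simp add: power_less_imp_less_base)
    have "x * \<delta>\<^sup>2 < 4 * r * \<delta>\<^sup>2" using small(3) r_pos by (simp add: \<epsilon>_def field_simps)
    then show "x / 4 < r" using \<delta> by simp
  qed
  define \<eta> where "\<eta> = min (\<delta> - \<bar>t - t0\<bar>) (min (r / 2) (min (r - x / 4) (\<delta> - r)))"
  \<comment> \<open>The barrier \<open>\<epsilon> / q\<close> is singular at the junction point, so it is replaced near \<open>r\<close> by the parabola
    \<open>\<epsilon> / r - \<epsilon> (q - r) / r\<^sup>2 + 2 \<epsilon> (q - r)\<^sup>2 / r\<^sup>3\<close>, which lies above it for \<open>q \<ge> r / 2\<close> and touches it at \<open>r\<close>.\<close>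
  define a b where ab: "a = 5 * \<epsilon> / r\<^sup>2" "b = - 1 - 2 * \<epsilon> / r^3"
  have "\<forall>\<^sub>F y in nhds (t, r). w (t, r) - paraboloid t0 a b (- 1) (t, r) \<le> w y - paraboloid t0 a b (- 1) y"
  proof (rule eventually_nhds_box)
    show "\<eta> > 0" using inner r_pos by (simp add: \<eta>_def)
    show "w (t, r) - paraboloid t0 a b (- 1) (t, r) \<le> w (t', q) - paraboloid t0 a b (- 1) (t', q)"
      if tq: "\<bar>t' - t\<bar> < \<eta>" "\<bar>q - r\<bar> < \<eta>" for t' q
    proof -
      have "\<bar>q - r\<bar> < r / 2" using tq(2) by (simp add: \<eta>_def)
      then have q: "q \<ge> r / 2" by linarith
      have "\<bar>t' - t\<bar> < \<delta> - \<bar>t - t0\<bar>" "\<bar>q - r\<bar> < r - x / 4" "\<bar>q - r\<bar> < \<delta> - r"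
        using tq by (simp_all add: \<eta>_def)
      then have "t0 - \<delta> \<le> t'" "t' \<le> t0 + \<delta>" "x / 4 \<le> q" "q \<le> \<delta>" by linarith+
      then have "f m \<le> f (t', q)" by (intro m(2)) (simp add: B_def)
      then have "w (t, r) + (t - t0)\<^sup>2 + r\<^sup>2 \<le> w (t', q) + (t' - t0)\<^sup>2 + q\<^sup>2 + (\<epsilon> / q - \<epsilon> / r)"
        unfolding m_eq f_def by simp
      moreover have "\<epsilon> / q - \<epsilon> / r \<le> 2 * \<epsilon> / r^3 * (q\<^sup>2 - r\<^sup>2) - a * (q - r)"
      proof -
        have "\<epsilon> / q - \<epsilon> / r = - (\<epsilon> / r\<^sup>2 * (q - r)) + \<epsilon> * (q - r)\<^sup>2 / (q * r\<^sup>2)"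
          using q r_pos by (simp add: field_simps power2_eq_square)
        moreover have "\<epsilon> * (q - r)\<^sup>2 / (q * r\<^sup>2) \<le> \<epsilon> * (q - r)\<^sup>2 / (r / 2 * r\<^sup>2)"
          using q r_pos \<epsilon> by (intro divide_left_mono mult_right_mono) auto
        moreover have "\<epsilon> * (q - r)\<^sup>2 / (r / 2 * r\<^sup>2) - \<epsilon> / r\<^sup>2 * (q - r)
            = 2 * \<epsilon> / r^3 * (q\<^sup>2 - r\<^sup>2) - a * (q - r)"
          using r_pos by (simp add: ab field_simps power2_eq_square power3_eq_cube)
        ultimately show ?thesis by linarith
      qed
      moreover define \<beta> where "\<beta> = 2 * \<epsilon> / r^3"
      ultimately show ?thesis
        unfolding paraboloid_def ab(2) \<beta>_def[symmetric] by (simp add: algebra_simps)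
    qed
  qed
  then have "lower_touching w t0 (t, r) (2 * (- 1) * (t - t0)) (a + 2 * b * r)"
    unfolding lower_touching_def by (intro exI[of _ a] exI[of _ b] exI[of _ "- 1"]) simp
  moreover have "\<bar>2 * (- 1) * (t - t0)\<bar> < d" using inner \<delta> by (simp add: abs_mult)
  moreover have "- d < a + 2 * b * r"
  proof -
    have "a + 2 * b * r = \<epsilon> / r\<^sup>2 - 2 * r"
      using r_pos by (simp add: ab field_simps power2_eq_square power3_eq_cube)
    moreover have "\<epsilon> / r\<^sup>2 \<ge> 0" using \<epsilon> by simp
    ultimately show ?thesis using inner \<delta> by linarith
  qed
  moreover have "\<bar>t - t0\<bar> < d" "r < d" using inner \<delta> by auto
  ultimately show ?thesis using r_pos by blast
qed


section \<open>Test functions on the junction\<close>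

lemma branch_point_0 [simp]: "branch_point i 0 = 0"
  by (simp add: branch_point_def)

lemma branch_point_component [simp]: "branch_point i r $ i = r"
  by (simp add: branch_point_def)

lemma inner_branch_point: "v \<bullet> branch_point i r = r * v $ i"
  by (simp add: branch_point_def inner_axis)

lemma norm_branch_point [simp]: "norm (branch_point i r) = \<bar>r\<bar>"
  by (simp add: branch_point_def)

lemma branch_point_in_junction: "0 \<le> r \<Longrightarrow> branch_point i r \<in> junction"
  by (auto simp: junction_def branch_def)

lemma junctionE:
  assumes "x \<in> junction"
  obtains i r where "0 \<le> r" "x = branch_point i r"
  using assms by (auto simp: junction_def branch_def)

lemma continuous_on_branch_point [continuous_intros]:
  "continuous_on S f \<Longrightarrow> continuous_on S (\<lambda>z. branch_point i (f z))"
  unfolding branch_point_def by (intro continuous_intros)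

definition branch_trace :: "'n::finite \<Rightarrow> (real \<times> (real ^ 'n) \<Rightarrow> real) \<Rightarrow> real \<times> real \<Rightarrow> real"
  where "branch_trace i f z = f (fst z, branch_point i (snd z))"

lemma branch_trace_eq: "branch_trace i f = (\<lambda>(t, r). f (t, branch_point i r))"
  by (auto simp: branch_trace_def)

lemma branch_trace_Pair [simp]: "branch_trace i f (t, r) = f (t, branch_point i r)"
  by (simp add: branch_trace_def)

lemma test_functions_iff:
  "\<phi> \<in> test_functions T \<longleftrightarrow> continuous_on (junction_T T) \<phi> \<and>
    (\<forall>i. C1_on ({0<..<T} \<times> {0..}) (branch_trace i \<phi>))"
  by (simp add: test_functions_def branch_trace_eq)

lemma test_function_derivative:
  fixes \<phi> :: "real \<times> (real ^ 'n::finite) \<Rightarrow> real"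
  assumes \<phi>: "\<phi> \<in> test_functions T"
  shows "\<exists>D. \<forall>i. (\<forall>z\<in>{0<..<T} \<times> {0..}.
      (branch_trace i \<phi> has_derivative blinfun_apply (D i z)) (at z within {0<..<T} \<times> {0..})) \<and>
      continuous_on ({0<..<T} \<times> {0..}) (D i)"
  by (rule choice) (use \<phi> in \<open>simp add: test_functions_iff C1_on_def\<close>)

lemma test_derivs_eq:
  assumes D: "(branch_trace i \<phi> has_derivative D) (at (t, r) within {0<..<T} \<times> {0..})"
    and t: "t \<in> {0<..<T}" and r: "0 \<le> r"
  shows "time_deriv \<phi> t (branch_point i r) = D (1, 0)"
    and "branch_deriv i \<phi> t (branch_point i r) = D (0, 1)"
proof -
  have lin: "linear D" using D by (rule has_derivative_linear)
  have "((\<lambda>s. branch_trace i \<phi> (s, r)) has_derivative (\<lambda>h. D (h, 0))) (at t within {0<..<T})"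
  proof (rule has_derivative_in_compose[where f = "\<lambda>s. (s, r)" and f' = "\<lambda>h. (h, 0)"])
    show "((\<lambda>s. (s, r)) has_derivative (\<lambda>h. (h, 0))) (at t within {0<..<T})"
      by (intro has_derivative_Pair has_derivative_ident has_derivative_const)
    show "(branch_trace i \<phi> has_derivative D) (at (t, r) within (\<lambda>s. (s, r)) ` {0<..<T})"
      by (rule has_derivative_subset[OF D]) (use r in auto)
  qed
  then have "((\<lambda>s. branch_trace i \<phi> (s, r)) has_derivative (\<lambda>h. h *\<^sub>R D (1, 0))) (at t within {0<..<T})"
    unfolding linear_scale[OF lin, symmetric] scaleR_Pair by simp
  moreover have "at t within {0<..<T} = at t"
    using t by (rule at_within_open[OF _ open_greaterThanLessThan])
  ultimately have "((\<lambda>s. \<phi> (s, branch_point i r)) has_vector_derivative D (1, 0)) (at t)"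
    unfolding has_vector_derivative_def branch_trace_Pair by simp
  then show "time_deriv \<phi> t (branch_point i r) = D (1, 0)"
    unfolding time_deriv_def by (rule vector_derivative_at)
  have "((\<lambda>q. branch_trace i \<phi> (t, q)) has_derivative (\<lambda>h. D (0, h))) (at r within {0..})"
  proof (rule has_derivative_in_compose[where f = "\<lambda>q. (t, q)" and f' = "\<lambda>h. (0, h)"])
    show "((\<lambda>q. (t, q)) has_derivative (\<lambda>h. (0, h))) (at r within {0..})"
      by (intro has_derivative_Pair has_derivative_ident has_derivative_const)
    show "(branch_trace i \<phi> has_derivative D) (at (t, r) within (\<lambda>q. (t, q)) ` {0..})"
      by (rule has_derivative_subset[OF D]) (use t in auto)
  qed
  then have "((\<lambda>q. branch_trace i \<phi> (t, q)) has_derivative (\<lambda>h. h *\<^sub>R D (0, 1))) (at r within {0..})"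
    unfolding linear_scale[OF lin, symmetric] scaleR_Pair by simp
  then have "((\<lambda>q. \<phi> (t, branch_point i q)) has_vector_derivative D (0, 1)) (at r within {0..})"
    unfolding has_vector_derivative_def branch_trace_Pair .
  moreover have "at r within {0..} \<noteq> bot"
  proof -
    have "at r within {r..r + 1} \<noteq> bot" by (simp add: at_within_Icc_at_right)
    moreover have "at r within {r..r + 1} \<le> at r within {0..}" using r by (intro at_le) auto
    ultimately show ?thesis by (auto simp: le_bot)
  qed
  ultimately show "branch_deriv i \<phi> t (branch_point i r) = D (0, 1)"
    unfolding branch_deriv_def branch_point_component by (intro vector_derivative_within)
qed

lemma test_function_continuous_derivs:
  assumes \<phi>: "\<phi> \<in> test_functions T"
  shows "continuous_on ({0<..<T} \<times> {0..}) (\<lambda>z. time_deriv \<phi> (fst z) (branch_point i (snd z)))"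
    and "continuous_on ({0<..<T} \<times> {0..}) (\<lambda>z. branch_deriv i \<phi> (fst z) (branch_point i (snd z)))"
proof -
  obtain D where D_all: "\<forall>i. (\<forall>z\<in>{0<..<T} \<times> {0..}.
      (branch_trace i \<phi> has_derivative blinfun_apply (D i z)) (at z within {0<..<T} \<times> {0..})) \<and>
      continuous_on ({0<..<T} \<times> {0..}) (D i)"
    using test_function_derivative[OF \<phi>] ..
  note D = D_all[rule_format, THEN conjunct1, rule_format]
    and cont = D_all[rule_format, THEN conjunct2]
  have eq: "time_deriv \<phi> (fst z) (branch_point i (snd z)) = D i z (1, 0)"
    "branch_deriv i \<phi> (fst z) (branch_point i (snd z)) = D i z (0, 1)"
    if z: "z \<in> {0<..<T} \<times> {0..}" for z
  proof -
    have "(branch_trace i \<phi> has_derivative D i z) (at (fst z, snd z) within {0<..<T} \<times> {0..})"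
      unfolding prod.collapse using z by (rule D)
    moreover have "fst z \<in> {0<..<T}" "0 \<le> snd z" using z by (simp_all add: mem_Times_iff)
    ultimately show "time_deriv \<phi> (fst z) (branch_point i (snd z)) = D i z (1, 0)"
      "branch_deriv i \<phi> (fst z) (branch_point i (snd z)) = D i z (0, 1)"
      by (rule test_derivs_eq)+
  qed
  have D_cont: "continuous_on ({0<..<T} \<times> {0..}) (\<lambda>z. D i z v)" for v
    by (rule bounded_linear.continuous_on[OF blinfun.bounded_linear_left cont])
  show "continuous_on ({0<..<T} \<times> {0..}) (\<lambda>z. time_deriv \<phi> (fst z) (branch_point i (snd z)))"
  proof (rule continuous_on_eq[OF D_cont[of "(1, 0)"]])
    show "D i z (1, 0) = time_deriv \<phi> (fst z) (branch_point i (snd z))"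
      if "z \<in> {0<..<T} \<times> {0..}" for z
      using eq(1)[OF that] by (rule sym)
  qed
  show "continuous_on ({0<..<T} \<times> {0..}) (\<lambda>z. branch_deriv i \<phi> (fst z) (branch_point i (snd z)))"
  proof (rule continuous_on_eq[OF D_cont[of "(0, 1)"]])
    show "D i z (0, 1) = branch_deriv i \<phi> (fst z) (branch_point i (snd z))"
      if "z \<in> {0<..<T} \<times> {0..}" for z
      using eq(2)[OF that] by (rule sym)
  qed
qed

lemma test_functions_minus:
  assumes \<phi>: "\<phi> \<in> test_functions T"
  shows "(\<lambda>z. - \<phi> z) \<in> test_functions T"
    and "t \<in> {0<..<T} \<Longrightarrow> 0 \<le> r \<Longrightarrow>
      time_deriv (\<lambda>z. - \<phi> z) t (branch_point i r) = - time_deriv \<phi> t (branch_point i r)"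
    and "t \<in> {0<..<T} \<Longrightarrow> 0 \<le> r \<Longrightarrow>
      branch_deriv i (\<lambda>z. - \<phi> z) t (branch_point i r) = - branch_deriv i \<phi> t (branch_point i r)"
proof -
  obtain D where D_all: "\<forall>i. (\<forall>z\<in>{0<..<T} \<times> {0..}.
      (branch_trace i \<phi> has_derivative blinfun_apply (D i z)) (at z within {0<..<T} \<times> {0..})) \<and>
      continuous_on ({0<..<T} \<times> {0..}) (D i)"
    using test_function_derivative[OF \<phi>] ..
  note D = D_all[rule_format, THEN conjunct1, rule_format]
    and cont = D_all[rule_format, THEN conjunct2]
  have D': "(branch_trace i (\<lambda>z. - \<phi> z) has_derivative blinfun_apply (- D i z))
      (at z within {0<..<T} \<times> {0..})" if "z \<in> {0<..<T} \<times> {0..}" for i z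
  proof -
    have "blinfun_apply (- D i z) = (\<lambda>h. - blinfun_apply (D i z) h)"
      by (simp add: fun_eq_iff blinfun.minus_left)
    then show ?thesis
      using has_derivative_minus[OF D[OF that, of i]] by (simp add: branch_trace_def[abs_def])
  qed
  have "C1_on ({0<..<T} \<times> {0..}) (branch_trace i (\<lambda>z. - \<phi> z))" for i
    unfolding C1_on_def
    by (intro exI[of _ "\<lambda>z. - D i z"] conjI ballI, erule D', rule continuous_on_minus[OF cont])
  then show "(\<lambda>z. - \<phi> z) \<in> test_functions T"
    using \<phi> by (simp add: test_functions_iff continuous_on_minus)
  assume tr: "t \<in> {0<..<T}" "0 \<le> r"
  then have mem: "(t, r) \<in> {0<..<T} \<times> {0..}" by auto
  show "time_deriv (\<lambda>z. - \<phi> z) t (branch_point i r) = - time_deriv \<phi> t (branch_point i r)"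
    "branch_deriv i (\<lambda>z. - \<phi> z) t (branch_point i r) = - branch_deriv i \<phi> t (branch_point i r)"
    unfolding test_derivs_eq[OF D[OF mem, of i] tr] test_derivs_eq[OF D'[OF mem, of i] tr]
    by (rule blinfun.minus_left)+
qed

text \<open>One family of perturbations serves two purposes. On the branch \<open>i\<close> it adds the
  paraboloid with linear coefficient \<open>v $ i\<close>; with \<open>b = 0\<close> it changes the slopes at the junction point
  independently of each other. The scalar products keep it defined on the whole space, hence
  continuous across the branches.\<close>

definition perturbed ::
    "(real \<times> (real ^ 'n) \<Rightarrow> real) \<Rightarrow> real \<Rightarrow> real ^ 'n::finite \<Rightarrow> real \<Rightarrow> real \<Rightarrow> real \<times> (real ^ 'n) \<Rightarrow> real"
  where "perturbed \<phi> t0 v b c z = \<phi> z + (v \<bullet> snd z + b * (snd z \<bullet> snd z) + c * (fst z - t0)\<^sup>2)"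

lemma branch_trace_perturbed:
  "branch_trace i (perturbed \<phi> t0 v b c) z = branch_trace i \<phi> z + paraboloid t0 (v $ i) b c z"
  by (simp add: branch_trace_def perturbed_def paraboloid_def inner_branch_point power2_eq_square
      branch_point_def inner_axis)

lemma test_functions_perturbed:
  assumes \<phi>: "\<phi> \<in> test_functions T"
  shows "perturbed \<phi> t0 v b c \<in> test_functions T"
    and "t \<in> {0<..<T} \<Longrightarrow> 0 \<le> r \<Longrightarrow> time_deriv (perturbed \<phi> t0 v b c) t (branch_point i r)
      = time_deriv \<phi> t (branch_point i r) + 2 * c * (t - t0)"
    and "t \<in> {0<..<T} \<Longrightarrow> 0 \<le> r \<Longrightarrow> branch_deriv i (perturbed \<phi> t0 v b c) t (branch_point i r)
      = branch_deriv i \<phi> t (branch_point i r) + (v $ i + 2 * b * r)"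
proof -
  obtain D where D_all: "\<forall>i. (\<forall>z\<in>{0<..<T} \<times> {0..}.
      (branch_trace i \<phi> has_derivative blinfun_apply (D i z)) (at z within {0<..<T} \<times> {0..})) \<and>
      continuous_on ({0<..<T} \<times> {0..}) (D i)"
    using test_function_derivative[OF \<phi>] ..
  note D = D_all[rule_format, THEN conjunct1, rule_format]
    and cont = D_all[rule_format, THEN conjunct2]
  define fst' snd' :: "(real \<times> real) \<Rightarrow>\<^sub>L real" where fs: "fst' = Blinfun fst" "snd' = Blinfun snd"
  have [simp]: "blinfun_apply fst' = fst" "blinfun_apply snd' = snd"
    by (simp_all add: fs bounded_linear_Blinfun_apply bounded_linear_fst bounded_linear_snd)
  define E where "E i z = D i z + ((v $ i + 2 * b * snd z) *\<^sub>R snd' + (2 * c * (fst z - t0)) *\<^sub>R fst')" for i z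
  have E_apply: "blinfun_apply (E i z) = (\<lambda>h. D i z h +
      ((v $ i + 2 * b * snd z) * snd h + 2 * c * (fst z - t0) * fst h))" for i z
    by (simp add: E_def fun_eq_iff blinfun.add_left blinfun.scaleR_left)
  have E: "(branch_trace i (perturbed \<phi> t0 v b c) has_derivative blinfun_apply (E i z))
      (at z within {0<..<T} \<times> {0..})" if "z \<in> {0<..<T} \<times> {0..}" for i z
  proof -
    have "((\<lambda>z. branch_trace i \<phi> z + paraboloid t0 (v $ i) b c z) has_derivative blinfun_apply (E i z))
      (at z within {0<..<T} \<times> {0..})"
      unfolding paraboloid_def
      unfolding E_apply by (rule derivative_eq_intros D[OF that] refl)+ (simp add: algebra_simps)
    then show ?thesis by (simp add: branch_trace_perturbed[abs_def])
  qed
  have E_cont: "continuous_on ({0<..<T} \<times> {0..}) (E i)" for i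
    unfolding E_def by (intro continuous_intros cont[of i])
  have "C1_on ({0<..<T} \<times> {0..}) (branch_trace i (perturbed \<phi> t0 v b c))" for i
    unfolding C1_on_def by (intro exI[of _ "E i"] conjI ballI) (erule E, rule E_cont)
  moreover have "continuous_on (junction_T T) (perturbed \<phi> t0 v b c)"
    using \<phi> unfolding perturbed_def test_functions_iff by (intro continuous_intros) auto
  ultimately show "perturbed \<phi> t0 v b c \<in> test_functions T"
    by (simp add: test_functions_iff)
  assume tr: "t \<in> {0<..<T}" "0 \<le> r"
  then have mem: "(t, r) \<in> {0<..<T} \<times> {0..}" by auto
  show "time_deriv (perturbed \<phi> t0 v b c) t (branch_point i r)
      = time_deriv \<phi> t (branch_point i r) + 2 * c * (t - t0)"
    "branch_deriv i (perturbed \<phi> t0 v b c) t (branch_point i r)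
      = branch_deriv i \<phi> t (branch_point i r) + (v $ i + 2 * b * r)"
    unfolding test_derivs_eq[OF D[OF mem, of i] tr] test_derivs_eq[OF E[OF mem, of i] tr]
    by (simp_all add: E_apply)
qed

lemma test_function_derivs_near_junction:
  assumes \<phi>: "\<phi> \<in> test_functions T" and t0: "t0 \<in> {0<..<T}" and \<kappa>: "\<kappa> > 0"
  shows "\<exists>d>0. d \<le> \<kappa> \<and> {t0 - d..t0 + d} \<subseteq> {0<..<T} \<and>
    (\<forall>t r. \<bar>t - t0\<bar> \<le> d \<longrightarrow> 0 \<le> r \<longrightarrow> r \<le> d \<longrightarrow>
      \<bar>time_deriv \<phi> t (branch_point i r) - time_deriv \<phi> t0 0\<bar> < \<kappa> \<and>
      \<bar>branch_deriv i \<phi> t (branch_point i r) - branch_deriv i \<phi> t0 0\<bar> < \<kappa>)"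
proof -
  let ?S = "{0<..<T} \<times> {0::real..}"
  have mem: "(t0, 0) \<in> ?S" using t0 by auto
  have at_0: "branch_point i (snd (t0, 0)) = 0" "fst (t0, 0::real) = t0" by simp_all
  obtain d1 where d1: "d1 > 0" "\<And>z. z \<in> ?S \<Longrightarrow> dist z (t0, 0) < d1 \<Longrightarrow>
      dist (time_deriv \<phi> (fst z) (branch_point i (snd z))) (time_deriv \<phi> t0 0) < \<kappa>"
    using test_function_continuous_derivs(1)[OF \<phi>, of i, unfolded continuous_on_iff,
        THEN bspec, OF mem, THEN spec, THEN mp, OF \<kappa>] unfolding at_0 by blast
  obtain d2 where d2: "d2 > 0" "\<And>z. z \<in> ?S \<Longrightarrow> dist z (t0, 0) < d2 \<Longrightarrow>
      dist (branch_deriv i \<phi> (fst z) (branch_point i (snd z))) (branch_deriv i \<phi> t0 0) < \<kappa>"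
    using test_function_continuous_derivs(2)[OF \<phi>, of i, unfolded continuous_on_iff,
        THEN bspec, OF mem, THEN spec, THEN mp, OF \<kappa>] unfolding at_0 by blast
  define d where "d = min \<kappa> (min (min (d1 / 3) (d2 / 3)) (min (t0 / 2) ((T - t0) / 2)))"
  have d: "d > 0" "d \<le> \<kappa>" "3 * d \<le> d1" "3 * d \<le> d2" "2 * d \<le> t0" "2 * d \<le> T - t0"
  proof -
    show "d > 0" using \<kappa> d1(1) d2(1) t0 by (simp add: d_def)
    have "d \<le> \<kappa>" "d \<le> min (d1 / 3) (d2 / 3)" "d \<le> min (t0 / 2) ((T - t0) / 2)"
      unfolding d_def by (rule min.cobounded1, meson min.cobounded1 min.coboundedI2,
        meson min.cobounded2 min.coboundedI2)
    then show "d \<le> \<kappa>" "3 * d \<le> d1" "3 * d \<le> d2" "2 * d \<le> t0" "2 * d \<le> T - t0" by simp_all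
  qed
  have bounds: "\<bar>time_deriv \<phi> t (branch_point i r) - time_deriv \<phi> t0 0\<bar> < \<kappa>"
      "\<bar>branch_deriv i \<phi> t (branch_point i r) - branch_deriv i \<phi> t0 0\<bar> < \<kappa>"
    if tr: "\<bar>t - t0\<bar> \<le> d" "0 \<le> r" "r \<le> d" for t r
  proof -
    have "dist (t, r) (t0, 0) < 3 * d"
      using norm_Pair_le[of "t - t0" r] tr d(1) by (simp add: dist_norm)
    moreover have "(t, r) \<in> ?S" using tr d by auto
    ultimately show "\<bar>time_deriv \<phi> t (branch_point i r) - time_deriv \<phi> t0 0\<bar> < \<kappa>"
      "\<bar>branch_deriv i \<phi> t (branch_point i r) - branch_deriv i \<phi> t0 0\<bar> < \<kappa>"
      using d1(2)[of "(t, r)"] d2(2)[of "(t, r)"] d by (simp_all add: dist_real_def)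
  qed
  have "{t0 - d..t0 + d} \<subseteq> {0<..<T}" using d by auto
  then show ?thesis
    by (intro exI[of _ d] conjI allI impI) (rule d | assumption | rule bounds; assumption)+
qed


section \<open>Exchanging the slopes at the junction point\<close>

lemma envelope_eq:
  assumes "continuous_on D u" and "z \<in> D"
  shows "upper_envelope D u z = u z" and "lower_envelope D u z = u z"
proof -
  let ?F = "inf (nhds z) (principal D)"
  have "(u \<longlongrightarrow> u z) ?F"
    using assms unfolding continuous_on_def by (simp add: tendsto_at_within_iff_tendsto_nhds)
  then have lim: "((\<lambda>w. ereal (u w)) \<longlongrightarrow> ereal (u z)) ?F" by (rule tendsto_ereal)
  have nontrivial: "?F \<noteq> bot"
  proof
    assume "?F = bot"
    then have "\<forall>\<^sub>F w in nhds z. w \<in> D \<longrightarrow> False"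
      unfolding eventually_inf_principal[symmetric] by simp
    then show False using assms(2) by (auto dest: eventually_nhds_x_imp_x)
  qed
  show "upper_envelope D u z = u z"
    unfolding upper_envelope_def lim_imp_Limsup[OF nontrivial lim] by simp
  show "lower_envelope D u z = u z"
    unfolding lower_envelope_def lim_imp_Liminf[OF nontrivial lim] by simp
qed

lemma touches_cong:
  assumes "\<And>w. w \<in> D \<Longrightarrow> v w = u w" and "z \<in> D"
  shows "touches_from_below D \<phi> v z \<longleftrightarrow> touches_from_below D \<phi> u z"
    and "touches_from_above D \<phi> v z \<longleftrightarrow> touches_from_above D \<phi> u z"
  using assms by (simp_all add: touches_from_below_def touches_from_above_def eventually_at_filter
      cong: imp_cong)

text \<open>The relaxed super-solution property with \<open>u\<close> in place of its envelope and for Hamiltonians without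
  any structure. Thus it also covers sub-solutions: if \<open>u\<close> is a sub-solution for \<open>H\<close> and \<open>F\<close>,
  then \<open>- u\<close> is a super-solution for \<open>- H\<^sub>i(- \<cdot>)\<close> and \<open>- F(- \<cdot>)\<close>, although these are in general not
  quasi-convex.\<close>

definition junction_supersolution ::
    "('n::finite \<Rightarrow> real \<Rightarrow> real) \<Rightarrow> (real ^ 'n \<Rightarrow> real) \<Rightarrow> real
      \<Rightarrow> (real \<times> (real ^ 'n) \<Rightarrow> real) \<Rightarrow> bool"
  where "junction_supersolution H F T u \<longleftrightarrow>
    (\<forall>\<phi>\<in>test_functions T. \<forall>(t, x)\<in>junction_T T.
      touches_from_below (junction_T T) \<phi> u (t, x) \<longrightarrow>
        (\<forall>i. x \<in> branch i - {0} \<longrightarrow> time_deriv \<phi> t x + H i (branch_deriv i \<phi> t x) \<ge> 0) \<and>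
        (x = 0 \<longrightarrow> time_deriv \<phi> t 0 + F (junction_gradient \<phi> t) \<ge> 0 \<or>
          (\<exists>i. time_deriv \<phi> t 0 + H i (branch_deriv i \<phi> t 0) \<ge> 0)))"

lemma junction_T_subset: "junction_T T \<subseteq> {0..<T} \<times> junction"
  by (auto simp: junction_T_def)

lemma relaxed_supersolution_junction:
  assumes u: "continuous_on ({0..<T} \<times> junction) u" and sup: "relaxed_supersolution H F T u"
  shows "junction_supersolution H F T u"
proof -
  have "touches_from_below (junction_T T) \<phi> (lower_envelope ({0..<T} \<times> junction) u) z
      \<longleftrightarrow> touches_from_below (junction_T T) \<phi> u z" if "z \<in> junction_T T" for \<phi> z
    using envelope_eq(2)[OF u] junction_T_subset that by (intro touches_cong) blast+
  then show ?thesis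
    using sup unfolding relaxed_supersolution_def junction_supersolution_def by fastforce
qed

lemma touches_from_above_minus:
  "touches_from_above D (\<lambda>z. - \<phi> z) u z \<longleftrightarrow> touches_from_below D \<phi> (\<lambda>z. - u z) z"
proof -
  have "u w - - \<phi> w \<le> u z - - \<phi> z \<longleftrightarrow> - u z - \<phi> z \<le> - u w - \<phi> w" for w by linarith
  then show ?thesis by (simp only: touches_from_above_def touches_from_below_def)
qed

lemma relaxed_subsolution_junction:
  assumes u: "continuous_on ({0..<T} \<times> junction) u" and sub: "relaxed_subsolution H F T u"
  shows "junction_supersolution (\<lambda>i p. - H i (- p)) (\<lambda>p. - F (- p)) T (\<lambda>z. - u z)"
  unfolding junction_supersolution_def
proof (intro ballI, clarify)
  fix \<phi> :: "real \<times> (real ^ 'a) \<Rightarrow> real" and t x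
  assume \<phi>: "\<phi> \<in> test_functions T" and tx: "(t, x) \<in> junction_T T"
    and "touches_from_below (junction_T T) \<phi> (\<lambda>z. - u z) (t, x)"
  then have "touches_from_above (junction_T T) (\<lambda>z. - \<phi> z) u (t, x)"
    by (simp add: touches_from_above_minus)
  moreover have "touches_from_above (junction_T T) \<psi> (upper_envelope ({0..<T} \<times> junction) u) (t, x)
      \<longleftrightarrow> touches_from_above (junction_T T) \<psi> u (t, x)" for \<psi>
    using envelope_eq(1)[OF u] junction_T_subset tx by (intro touches_cong) blast+
  ultimately have touch: "touches_from_above (junction_T T) (\<lambda>z. - \<phi> z)
      (upper_envelope ({0..<T} \<times> junction) u) (t, x)" by simp
  have t: "t \<in> {0<..<T}" using tx by (simp add: junction_T_def)
  note minus = test_functions_minus(2,3)[OF \<phi> t]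
  have minus_0: "time_deriv (\<lambda>z. - \<phi> z) t 0 = - time_deriv \<phi> t 0"
    "branch_deriv i (\<lambda>z. - \<phi> z) t 0 = - branch_deriv i \<phi> t 0" for i
    using minus[of 0] by simp_all
  have grad: "junction_gradient (\<lambda>z. - \<phi> z) t = - junction_gradient \<phi> t"
    by (simp add: junction_gradient_def minus_0 vec_eq_iff)
  have rel: "(\<forall>i. x \<in> branch i - {0} \<longrightarrow>
        time_deriv (\<lambda>z. - \<phi> z) t x + H i (branch_deriv i (\<lambda>z. - \<phi> z) t x) \<le> 0) \<and>
      (x = 0 \<longrightarrow> time_deriv (\<lambda>z. - \<phi> z) t 0 + F (junction_gradient (\<lambda>z. - \<phi> z) t) \<le> 0 \<or>
        (\<exists>i. time_deriv (\<lambda>z. - \<phi> z) t 0 + H i (branch_deriv i (\<lambda>z. - \<phi> z) t 0) \<le> 0))"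
    using sub test_functions_minus(1)[OF \<phi>] tx touch unfolding relaxed_subsolution_def by fastforce
  show "(\<forall>i. x \<in> branch i - {0} \<longrightarrow> 0 \<le> time_deriv \<phi> t x + - H i (- branch_deriv i \<phi> t x)) \<and>
      (x = 0 \<longrightarrow> 0 \<le> time_deriv \<phi> t 0 + - F (- junction_gradient \<phi> t) \<or>
        (\<exists>i. 0 \<le> time_deriv \<phi> t 0 + - H i (- branch_deriv i \<phi> t 0)))"
  proof (intro conjI allI impI)
    fix i assume x: "x \<in> branch i - {0}"
    then obtain r where r: "0 \<le> r" "x = branch_point i r" by (auto simp: branch_def)
    have "time_deriv (\<lambda>z. - \<phi> z) t x + H i (branch_deriv i (\<lambda>z. - \<phi> z) t x) \<le> 0"
      using rel x by blast
    then show "0 \<le> time_deriv \<phi> t x + - H i (- branch_deriv i \<phi> t x)"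
      unfolding r(2) minus[OF r(1)] by simp
  next
    assume "x = 0"
    with rel have "time_deriv (\<lambda>z. - \<phi> z) t 0 + F (junction_gradient (\<lambda>z. - \<phi> z) t) \<le> 0 \<or>
        (\<exists>i. time_deriv (\<lambda>z. - \<phi> z) t 0 + H i (branch_deriv i (\<lambda>z. - \<phi> z) t 0) \<le> 0)" by blast
    then show "0 \<le> time_deriv \<phi> t 0 + - F (- junction_gradient \<phi> t) \<or>
        (\<exists>i. 0 \<le> time_deriv \<phi> t 0 + - H i (- branch_deriv i \<phi> t 0))"
      unfolding minus_0 grad by simp
  qed
qed

lemma junction_point_eq_branch_point:
  assumes "x \<in> junction" and "0 < x $ i"
  shows "x = branch_point i (x $ i)"
proof -
  obtain j r where "x = branch_point j r" using assms(1) by (rule junctionE)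
  then show ?thesis using assms(2) by (cases "i = j") (auto simp: branch_point_def axis_def)
qed

text \<open>Near a point with \<open>r > 0\<close> the junction is the branch, so a touching paraboloid in the coordinates
  \<open>(t, r)\<close>, added to \<open>\<phi>\<close>, is an admissible test function.\<close>

lemma branch_inequality:
  assumes sup: "junction_supersolution H F T u" and \<phi>: "\<phi> \<in> test_functions T"
    and t: "t \<in> {0<..<T}" and r: "0 < r"
    and touch: "lower_touching (\<lambda>z. branch_trace i u z - branch_trace i \<phi> z - C) t0 (t, r) \<tau> p"
  shows "0 \<le> time_deriv \<phi> t (branch_point i r) + \<tau> + H i (branch_deriv i \<phi> t (branch_point i r) + p)"
proof -
  obtain a b c where \<tau>: "\<tau> = 2 * c * (t - t0)" and p: "p = a + 2 * b * r"
    and ev: "\<forall>\<^sub>F y in nhds (t, r).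
      branch_trace i u (t, r) - branch_trace i \<phi> (t, r) - C - paraboloid t0 a b c (t, r)
      \<le> branch_trace i u y - branch_trace i \<phi> y - C - paraboloid t0 a b c y"
    using touch unfolding lower_touching_def by auto
  define \<psi> where "\<psi> = perturbed \<phi> t0 (\<chi> j. a) b c"
  have \<psi>_trace: "branch_trace i \<psi> z = branch_trace i \<phi> z + paraboloid t0 a b c z" for z
    by (simp add: \<psi>_def branch_trace_perturbed)
  let ?x = "branch_point i r"
  have lim: "((\<lambda>y. (fst y, snd y $ i)) \<longlongrightarrow> (t, r)) (nhds (t, ?x))"
  proof -
    have "((\<lambda>y. (fst y, snd y $ i)) \<longlongrightarrow> (fst (t, ?x), snd (t, ?x) $ i)) (nhds (t, ?x))"
      by (intro tendsto_intros filterlim_ident)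
    then show ?thesis by simp
  qed
  have "\<forall>\<^sub>F y in nhds (t, r). 0 < snd y"
  proof (rule eventually_nhds_box[OF r])
    show "0 < snd (s, q)" if "\<bar>q - r\<bar> < r" for s q using that by auto
  qed
  with ev have "\<forall>\<^sub>F y in nhds (t, r). 0 < snd y \<and>
      branch_trace i u (t, r) - branch_trace i \<psi> (t, r) \<le> branch_trace i u y - branch_trace i \<psi> y"
    unfolding \<psi>_trace by eventually_elim simp
  then have "\<forall>\<^sub>F y in nhds (t, ?x). 0 < snd y $ i \<and>
      branch_trace i u (t, r) - branch_trace i \<psi> (t, r)
      \<le> branch_trace i u (fst y, snd y $ i) - branch_trace i \<psi> (fst y, snd y $ i)"
    using eventually_compose_filterlim[OF _ lim] by fastforce
  then have "\<forall>\<^sub>F y in nhds (t, ?x). y \<noteq> (t, ?x) \<longrightarrow> y \<in> junction_T T \<longrightarrow> u (t, ?x) - \<psi> (t, ?x) \<le> u y - \<psi> y"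
  proof eventually_elim
    case (elim y)
    show ?case
    proof (intro impI)
      assume "y \<in> junction_T T"
      then have "snd y \<in> junction" by (auto simp: junction_T_def)
      then have "branch_point i (snd y $ i) = snd y"
        using elim junction_point_eq_branch_point by metis
      then show "u (t, ?x) - \<psi> (t, ?x) \<le> u y - \<psi> y" using elim by simp
    qed
  qed
  then have "touches_from_below (junction_T T) \<psi> u (t, ?x)"
    by (simp add: touches_from_below_def eventually_at_filter)
  moreover have "(t, ?x) \<in> junction_T T"
    using t r by (auto simp: junction_T_def intro: branch_point_in_junction)
  moreover have "?x \<in> branch i - {0}"
    using r by (auto simp: branch_def branch_point_def)
  moreover have "\<psi> \<in> test_functions T" unfolding \<psi>_def using \<phi> by (rule test_functions_perturbed)
  ultimately have "0 \<le> time_deriv \<psi> t ?x + H i (branch_deriv i \<psi> t ?x)"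
    using sup unfolding junction_supersolution_def by fastforce
  then show ?thesis
    using test_functions_perturbed(2,3)[OF \<phi> t less_imp_le[OF r]]
    by (simp add: \<psi>_def \<tau> p)
qed

text \<open>The barriers on the branches have to be glued to one test function. They agree at \<open>r = 0\<close> once they have a
  common time penalty, so the sum \<open>K\<close> of all coefficients replaces each of them; it does not
  change the derivatives at \<open>(t\<^sub>0, 0)\<close>.\<close>

lemma junction_inequality_of_slopes:
  fixes v :: "real ^ 'n::finite"
  assumes sup: "junction_supersolution H F T u" and \<phi>: "\<phi> \<in> test_functions T" and t0: "t0 \<in> {0<..<T}"
    and below: "\<And>i. \<exists>k\<ge>0. \<exists>e>0. \<forall>t r. \<bar>t - t0\<bar> \<le> e \<longrightarrow> 0 \<le> r \<longrightarrow> r \<le> e \<longrightarrow>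
      v $ i * r - k * (t - t0)\<^sup>2
      \<le> branch_trace i u (t, r) - branch_trace i \<phi> (t, r) - (u (t0, 0) - \<phi> (t0, 0))"
  shows "0 \<le> time_deriv \<phi> t0 0 + F (junction_gradient \<phi> t0 + v) \<or>
    (\<exists>i. 0 \<le> time_deriv \<phi> t0 0 + H i (branch_deriv i \<phi> t0 0 + v $ i))"
proof -
  have "\<forall>i. \<exists>k. 0 \<le> k \<and> (\<exists>e>0. \<forall>t r. \<bar>t - t0\<bar> \<le> e \<longrightarrow> 0 \<le> r \<longrightarrow> r \<le> e \<longrightarrow>
      v $ i * r - k * (t - t0)\<^sup>2
      \<le> branch_trace i u (t, r) - branch_trace i \<phi> (t, r) - (u (t0, 0) - \<phi> (t0, 0)))"
    using below by simp
  from choice[OF this] obtain k where k: "\<And>i. 0 \<le> k i"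
    and k_below: "\<And>i. \<exists>e>0. \<forall>t r. \<bar>t - t0\<bar> \<le> e \<longrightarrow> 0 \<le> r \<longrightarrow> r \<le> e \<longrightarrow>
      v $ i * r - k i * (t - t0)\<^sup>2
      \<le> branch_trace i u (t, r) - branch_trace i \<phi> (t, r) - (u (t0, 0) - \<phi> (t0, 0))"
    by blast
  define K where "K = sum k UNIV"
  have K: "k i \<le> K" for i unfolding K_def using k by (intro member_le_sum) auto
  define \<psi> where "\<psi> = perturbed \<phi> t0 v 0 (- K)"
  have \<psi>_trace: "branch_trace i \<psi> z = branch_trace i \<phi> z + paraboloid t0 (v $ i) 0 (- K) z" for i z
    by (simp add: \<psi>_def branch_trace_perturbed)
  have \<psi>_0: "\<psi> (t0, 0) = \<phi> (t0, 0)" by (simp add: \<psi>_def perturbed_def)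
  have near: "\<forall>\<^sub>F y in nhds (t0, 0). \<forall>r\<ge>0. snd y = branch_point i r \<longrightarrow> u (t0, 0) - \<psi> (t0, 0) \<le> u y - \<psi> y" for i
  proof -
    obtain e where e: "e > 0" and e_below: "\<And>t r. \<bar>t - t0\<bar> \<le> e \<Longrightarrow> 0 \<le> r \<Longrightarrow> r \<le> e \<Longrightarrow>
        v $ i * r - k i * (t - t0)\<^sup>2
        \<le> branch_trace i u (t, r) - branch_trace i \<phi> (t, r) - (u (t0, 0) - \<phi> (t0, 0))"
      using k_below[of i] by blast
    have "\<forall>\<^sub>F y in nhds (t0, 0 :: real ^ 'n). y \<in> ball (t0, 0) e"
      using e by (intro eventually_nhds_in_open) auto
    then show ?thesis
    proof eventually_elim
      case (elim y)
      show ?case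
      proof (intro allI impI)
        fix r :: real assume r: "0 \<le> r" "snd y = branch_point i r"
        then have y: "y = (fst y, branch_point i r)" by (metis prod.collapse)
        have "dist (t0, 0) y < e" using elim by simp
        then have "\<bar>fst y - t0\<bar> \<le> e" "r \<le> e"
          using r dist_fst_le[of "(t0, 0)" y] dist_snd_le[of "(t0, 0)" y]
          by (simp_all add: dist_real_def dist_norm abs_minus_commute)
        then have "v $ i * r - k i * (fst y - t0)\<^sup>2
            \<le> branch_trace i u (fst y, r) - branch_trace i \<phi> (fst y, r) - (u (t0, 0) - \<phi> (t0, 0))"
          using r(1) by (intro e_below)
        moreover have "k i * (fst y - t0)\<^sup>2 \<le> K * (fst y - t0)\<^sup>2"
          by (intro mult_right_mono K) simp
        ultimately have "u (t0, 0) - \<psi> (t0, 0) \<le> branch_trace i u (fst y, r) - branch_trace i \<psi> (fst y, r)"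
          unfolding \<psi>_trace \<psi>_0 paraboloid_def fst_conv snd_conv by simp
        then show "u (t0, 0) - \<psi> (t0, 0) \<le> u y - \<psi> y"
          unfolding branch_trace_Pair y[symmetric] .
      qed
    qed
  qed
  have "\<forall>\<^sub>F y in nhds (t0, 0). \<forall>i. \<forall>r\<ge>0. snd y = branch_point i r \<longrightarrow> u (t0, 0) - \<psi> (t0, 0) \<le> u y - \<psi> y"
    by (intro eventually_all_finite near)
  then have "\<forall>\<^sub>F y in nhds (t0, 0). y \<noteq> (t0, 0) \<longrightarrow> y \<in> junction_T T \<longrightarrow> u (t0, 0) - \<psi> (t0, 0) \<le> u y - \<psi> y"
    by eventually_elim (auto simp: junction_T_def elim: junctionE)
  then have "touches_from_below (junction_T T) \<psi> u (t0, 0)"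
    by (simp add: touches_from_below_def eventually_at_filter)
  moreover have "(t0, 0) \<in> junction_T T"
    using t0 branch_point_in_junction[of 0] by (auto simp: junction_T_def)
  moreover have "\<psi> \<in> test_functions T" unfolding \<psi>_def using \<phi> by (rule test_functions_perturbed)
  ultimately have "0 \<le> time_deriv \<psi> t0 0 + F (junction_gradient \<psi> t0) \<or>
      (\<exists>i. 0 \<le> time_deriv \<psi> t0 0 + H i (branch_deriv i \<psi> t0 0))"
    using sup unfolding junction_supersolution_def by fastforce
  moreover have "time_deriv \<psi> t0 0 = time_deriv \<phi> t0 0"
    "branch_deriv i \<psi> t0 0 = branch_deriv i \<phi> t0 0 + v $ i" for i
    using test_functions_perturbed(2,3)[OF \<phi> t0, of 0] by (simp_all add: \<psi>_def)
  moreover from this have "junction_gradient \<psi> t0 = junction_gradient \<phi> t0 + v"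
    by (simp add: junction_gradient_def vec_eq_iff)
  ultimately show ?thesis by simp
qed

text \<open>Translates the equation on the branch \<open>i\<close> into a restriction on the slopes of paraboloids that touch
  \<open>u - \<phi>\<close> near \<open>(t\<^sub>0, 0)\<close>: as the derivatives of \<open>\<phi>\<close> are continuous, they can be
  replaced by their values at the junction point at the price of an error below \<open>\<kappa>\<close>. The bound
  \<open>\<kappa> - d\<close> leaves room for a further \<open>d\<close> in the application of \<open>raise_slope\<close>.\<close>

lemma touching_near_junction:
  assumes sup: "junction_supersolution H F T u" and u: "continuous_on (junction_T T) u"
    and \<phi>: "\<phi> \<in> test_functions T" and t0: "t0 \<in> {0<..<T}"
    and touch: "touches_from_below (junction_T T) \<phi> u (t0, 0)" and \<kappa>: "0 < \<kappa>"
  defines "w \<equiv> \<lambda>i z. branch_trace i u z - branch_trace i \<phi> z - (u (t0, 0) - \<phi> (t0, 0))"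
  shows "\<exists>d>0. continuous_on ({t0 - d..t0 + d} \<times> {0..d}) (w i) \<and>
    (\<forall>t r. \<bar>t - t0\<bar> \<le> d \<longrightarrow> 0 \<le> r \<longrightarrow> r \<le> d \<longrightarrow> 0 \<le> w i (t, r)) \<and>
    (\<forall>t r \<tau> p. \<bar>t - t0\<bar> < d \<longrightarrow> 0 < r \<longrightarrow> r < d \<longrightarrow> \<bar>\<tau>\<bar> < d \<longrightarrow> lower_touching (w i) t0 (t, r) \<tau> p \<longrightarrow>
      (\<exists>x. \<bar>x - (branch_deriv i \<phi> t0 0 + p)\<bar> < \<kappa> - d \<and> 0 \<le> time_deriv \<phi> t0 0 + \<kappa> + H i x))"
proof -
  obtain d1 where d1: "d1 > 0" "d1 \<le> \<kappa> / 2" "{t0 - d1..t0 + d1} \<subseteq> {0<..<T}"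
    and bounds: "\<And>t r. \<bar>t - t0\<bar> \<le> d1 \<Longrightarrow> 0 \<le> r \<Longrightarrow> r \<le> d1 \<Longrightarrow>
      \<bar>time_deriv \<phi> t (branch_point i r) - time_deriv \<phi> t0 0\<bar> < \<kappa> / 2 \<and>
      \<bar>branch_deriv i \<phi> t (branch_point i r) - branch_deriv i \<phi> t0 0\<bar> < \<kappa> / 2"
    using test_function_derivs_near_junction[OF \<phi> t0, of "\<kappa> / 2" i] \<kappa> by auto
  obtain d2 where d2: "d2 > 0" and below: "\<And>y. y \<in> junction_T T \<Longrightarrow> dist y (t0, 0) < d2 \<Longrightarrow>
      u (t0, 0) - \<phi> (t0, 0) \<le> u y - \<phi> y"
    using touch unfolding touches_from_below_def eventually_at by (metis order_refl)
  define d where "d = min d1 (d2 / 3)"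
  have d: "0 < d" "d \<le> d1" "3 * d \<le> d2" using d1(1) d2 by (auto simp: d_def)
  have d_T: "t \<in> {0<..<T}" if "\<bar>t - t0\<bar> \<le> d" for t
    using that d(2) d1(3) by (intro subsetD[OF d1(3)]) auto
  have "continuous_on ({t0 - d..t0 + d} \<times> {0..d}) (branch_trace i f)"
    if "continuous_on (junction_T T) f" for f
    unfolding branch_trace_def
  proof (rule continuous_on_compose2[OF that])
    show "continuous_on ({t0 - d..t0 + d} \<times> {0..d}) (\<lambda>z. (fst z, branch_point i (snd z)))"
      by (intro continuous_intros)
    show "(\<lambda>z. (fst z, branch_point i (snd z))) ` ({t0 - d..t0 + d} \<times> {0..d}) \<subseteq> junction_T T"
      using d_T by (auto simp: junction_T_def branch_point_in_junction abs_le_iff)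
  qed
  from this[OF u] this[of \<phi>] have "continuous_on ({t0 - d..t0 + d} \<times> {0..d}) (w i)"
    unfolding w_def using \<phi> by (intro continuous_intros) (auto simp: test_functions_iff)
  moreover have "0 \<le> w i (t, r)" if tr: "\<bar>t - t0\<bar> \<le> d" "0 \<le> r" "r \<le> d" for t r
  proof -
    have "(t, branch_point i r) \<in> junction_T T"
      using d_T[OF tr(1)] tr by (auto simp: junction_T_def branch_point_in_junction)
    moreover have "dist (t, branch_point i r) (t0, 0) < d2"
      using norm_Pair_le[of "t - t0" "branch_point i r"] tr d by (simp add: dist_norm)
    ultimately show ?thesis using below by (fastforce simp: w_def)
  qed
  moreover have "\<exists>x. \<bar>x - (branch_deriv i \<phi> t0 0 + p)\<bar> < \<kappa> - d \<and> 0 \<le> time_deriv \<phi> t0 0 + \<kappa> + H i x"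
    if tr: "\<bar>t - t0\<bar> < d" "0 < r" "r < d" "\<bar>\<tau>\<bar> < d" and lt: "lower_touching (w i) t0 (t, r) \<tau> p" for t r \<tau> p
  proof -
    let ?x = "branch_deriv i \<phi> t (branch_point i r) + p"
    have "t \<in> {0<..<T}" using tr by (intro d_T) simp
    then have "0 \<le> time_deriv \<phi> t (branch_point i r) + \<tau> + H i ?x"
      using lt unfolding w_def by (rule branch_inequality[OF sup \<phi> _ tr(2)])
    moreover have "\<bar>time_deriv \<phi> t (branch_point i r) - time_deriv \<phi> t0 0\<bar> < \<kappa> / 2 \<and>
      \<bar>branch_deriv i \<phi> t (branch_point i r) - branch_deriv i \<phi> t0 0\<bar> < \<kappa> / 2"
      using tr d by (intro bounds) auto
    ultimately have "\<bar>?x - (branch_deriv i \<phi> t0 0 + p)\<bar> < \<kappa> - d" "0 \<le> time_deriv \<phi> t0 0 + \<kappa> + H i ?x"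
      using tr d d1(2) by linarith+
    then show ?thesis by blast
  qed
  ultimately show ?thesis using d(1) by (intro exI[of _ d]) blast
qed

text \<open>The relaxed condition holds not only for the slopes of \<open>\<phi>\<close> but also for every other choice of slopes, as
  long as no slope is raised across values that the equation on the branch permits. Lowering is
  always admissible because \<open>r \<ge> 0\<close>.\<close>

lemma junction_inequality:
  fixes v :: "real ^ 'n::finite"
  assumes sup: "junction_supersolution H F T u" and u: "continuous_on (junction_T T) u"
    and \<phi>: "\<phi> \<in> test_functions T" and t0: "t0 \<in> {0<..<T}"
    and touch: "touches_from_below (junction_T T) \<phi> u (t0, 0)"
    and forbidden: "\<And>i. 0 < v $ i \<Longrightarrow> \<exists>\<kappa>>0. \<forall>x.
      branch_deriv i \<phi> t0 0 - \<kappa> \<le> x \<longrightarrow> x \<le> branch_deriv i \<phi> t0 0 + v $ i + \<kappa> \<longrightarrow>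
      time_deriv \<phi> t0 0 + \<kappa> + H i x < 0"
  shows "0 \<le> time_deriv \<phi> t0 0 + F (junction_gradient \<phi> t0 + v) \<or>
    (\<exists>i. 0 \<le> time_deriv \<phi> t0 0 + H i (branch_deriv i \<phi> t0 0 + v $ i))"
proof (rule junction_inequality_of_slopes[OF sup \<phi> t0])
  fix i
  let ?w = "\<lambda>z. branch_trace i u z - branch_trace i \<phi> z - (u (t0, 0) - \<phi> (t0, 0))"
  show "\<exists>k\<ge>0. \<exists>e>0. \<forall>t r. \<bar>t - t0\<bar> \<le> e \<longrightarrow> 0 \<le> r \<longrightarrow> r \<le> e \<longrightarrow>
      v $ i * r - k * (t - t0)\<^sup>2
      \<le> branch_trace i u (t, r) - branch_trace i \<phi> (t, r) - (u (t0, 0) - \<phi> (t0, 0))"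
  proof (cases "0 < v $ i")
    case True
    then obtain \<kappa> where \<kappa>: "0 < \<kappa>"
      and neg: "\<And>x. branch_deriv i \<phi> t0 0 - \<kappa> \<le> x \<Longrightarrow> x \<le> branch_deriv i \<phi> t0 0 + v $ i + \<kappa> \<Longrightarrow>
        time_deriv \<phi> t0 0 + \<kappa> + H i x < 0"
      using forbidden by blast
    obtain d where d: "0 < d" "continuous_on ({t0 - d..t0 + d} \<times> {0..d}) ?w"
      and nonneg: "\<And>t r. \<bar>t - t0\<bar> \<le> d \<Longrightarrow> 0 \<le> r \<Longrightarrow> r \<le> d \<Longrightarrow> 0 \<le> ?w (t, r)"
      and slopes: "\<And>t r \<tau> p. \<bar>t - t0\<bar> < d \<Longrightarrow> 0 < r \<Longrightarrow> r < d \<Longrightarrow> \<bar>\<tau>\<bar> < d \<Longrightarrow> lower_touching ?w t0 (t, r) \<tau> p \<Longrightarrow>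
        \<exists>x. \<bar>x - (branch_deriv i \<phi> t0 0 + p)\<bar> < \<kappa> - d \<and> 0 \<le> time_deriv \<phi> t0 0 + \<kappa> + H i x"
      using touching_near_junction[OF sup u \<phi> t0 touch \<kappa>, of i] by blast
    show ?thesis
    proof (rule raise_slope[OF d _ nonneg less_imp_le[OF True]])
      fix t r \<tau> p
      assume *: "\<bar>t - t0\<bar> < d" "0 < r" "r < d" "\<bar>\<tau>\<bar> < d" "- d < p" "p < v $ i + d"
      show "\<not> lower_touching ?w t0 (t, r) \<tau> p"
      proof
        assume "lower_touching ?w t0 (t, r) \<tau> p"
        then obtain x where x: "\<bar>x - (branch_deriv i \<phi> t0 0 + p)\<bar> < \<kappa> - d"
          "0 \<le> time_deriv \<phi> t0 0 + \<kappa> + H i x"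
          using slopes[OF *(1-4)] by blast
        have "time_deriv \<phi> t0 0 + \<kappa> + H i x < 0"
          using x(1) * by (intro neg) linarith+
        then show False using x(2) by linarith
      qed
    qed
  next
    case False
    obtain d where d: "0 < d"
      and nonneg: "\<And>t r. \<bar>t - t0\<bar> \<le> d \<Longrightarrow> 0 \<le> r \<Longrightarrow> r \<le> d \<Longrightarrow> 0 \<le> ?w (t, r)"
      using touching_near_junction[OF sup u \<phi> t0 touch zero_less_one, of i] by blast
    have "v $ i * r - 0 * (t - t0)\<^sup>2 \<le> ?w (t, r)" if "\<bar>t - t0\<bar> \<le> d" "0 \<le> r" "r \<le> d" for t r
      using nonneg[OF that] mult_nonpos_nonneg[of "v $ i" r] False that(2) by linarith
    then show ?thesis using d by (intro exI[of _ 0]) (auto intro!: exI[of _ d])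
  qed
qed

text \<open>This is what is left of the equation at the junction point on each single branch: since \<open>u\<close> is continuous, it
  cannot detach from \<open>\<phi>\<close> with an infinite slope.\<close>

lemma steep_slope_allowed:
  assumes sup: "junction_supersolution H F T u" and u: "continuous_on (junction_T T) u"
    and \<phi>: "\<phi> \<in> test_functions T" and t0: "t0 \<in> {0<..<T}"
    and touch: "touches_from_below (junction_T T) \<phi> u (t0, 0)" and \<kappa>: "0 < \<kappa>"
  shows "\<exists>x > branch_deriv i \<phi> t0 0 - \<kappa>. 0 \<le> time_deriv \<phi> t0 0 + \<kappa> + H i x"
proof -
  let ?w = "\<lambda>z. branch_trace i u z - branch_trace i \<phi> z - (u (t0, 0) - \<phi> (t0, 0))"
  obtain d where d: "0 < d" "continuous_on ({t0 - d..t0 + d} \<times> {0..d}) ?w"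
    and nonneg: "\<And>t r. \<bar>t - t0\<bar> \<le> d \<Longrightarrow> 0 \<le> r \<Longrightarrow> r \<le> d \<Longrightarrow> 0 \<le> ?w (t, r)"
    and slopes: "\<And>t r \<tau> p. \<bar>t - t0\<bar> < d \<Longrightarrow> 0 < r \<Longrightarrow> r < d \<Longrightarrow> \<bar>\<tau>\<bar> < d \<Longrightarrow> lower_touching ?w t0 (t, r) \<tau> p \<Longrightarrow>
      \<exists>x. \<bar>x - (branch_deriv i \<phi> t0 0 + p)\<bar> < \<kappa> - d \<and> 0 \<le> time_deriv \<phi> t0 0 + \<kappa> + H i x"
    using touching_near_junction[OF sup u \<phi> t0 touch \<kappa>, of i] by blast
  have "?w (t0, 0) = 0" by simp
  from touched_by_large_slope[OF d nonneg this] obtain t r \<tau> p where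
    *: "\<bar>t - t0\<bar> < d" "0 < r" "r < d" "\<bar>\<tau>\<bar> < d" and p: "- d < p"
    and "lower_touching ?w t0 (t, r) \<tau> p" by blast
  then obtain x where x: "\<bar>x - (branch_deriv i \<phi> t0 0 + p)\<bar> < \<kappa> - d"
    "0 \<le> time_deriv \<phi> t0 0 + \<kappa> + H i x"
    using slopes[OF *] by blast
  moreover have "branch_deriv i \<phi> t0 0 - \<kappa> < x" using x(1) p by linarith
  ultimately show ?thesis by blast
qed


section \<open>Quasi-convex coercive Hamiltonians\<close>

lemma nonincreasing_part_min:
  assumes "turning_point h p0"
  shows "nonincreasing_part h q = h (min q p0)"
  by (simp add: nonincreasing_part_eq[OF assms] min_def)

lemma turning_point_antimono: "turning_point h p0 \<Longrightarrow> x \<le> y \<Longrightarrow> y \<le> p0 \<Longrightarrow> h y \<le> h x"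
  by (auto simp: turning_point_def monotone_on_def)

lemma turning_point_mono: "turning_point h p0 \<Longrightarrow> p0 \<le> x \<Longrightarrow> x \<le> y \<Longrightarrow> h x \<le> h y"
  by (auto simp: turning_point_def monotone_on_def)

lemma flux_limiter_less_iff:
  fixes H :: "'n::finite \<Rightarrow> real \<Rightarrow> real"
  shows "flux_limiter H (ereal A) p < c \<longleftrightarrow> A < c \<and> (\<forall>i. nonincreasing_part (H i) (p $ i) < c)"
  unfolding flux_limiter_def ereal_max[symmetric] real_of_ereal.simps by simp

lemma less_flux_limiter_iff:
  fixes H :: "'n::finite \<Rightarrow> real \<Rightarrow> real"
  shows "c < flux_limiter H (ereal A) p \<longleftrightarrow> c < A \<or> (\<exists>i. c < nonincreasing_part (H i) (p $ i))"
  unfolding flux_limiter_def ereal_max[symmetric] real_of_ereal.simps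
  by (simp add: less_max_iff_disj Max_gr_iff)

lemma continuous_less_near:
  fixes h :: "real \<Rightarrow> real"
  assumes "continuous_on UNIV h" and "h a < c"
  obtains \<kappa> where "0 < \<kappa>" and "\<And>x. \<bar>x - a\<bar> \<le> \<kappa> \<Longrightarrow> h x + \<kappa> < c"
proof -
  define m where "m = (c - h a) / 2"
  have m: "0 < m" "h a + m + m = c" using assms(2) by (simp_all add: m_def field_simps)
  obtain e where e: "0 < e" "\<And>x. dist x a < e \<Longrightarrow> dist (h x) (h a) < m"
    using assms(1) m(1) unfolding continuous_on_iff by blast
  show ?thesis
  proof (rule that[of "min (e / 2) m"])
    show "0 < min (e / 2) m" using e m by simp
    fix x assume x: "\<bar>x - a\<bar> \<le> min (e / 2) m"
    then have "dist x a < e" using e(1) by (simp add: dist_real_def)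
    then have "\<bar>h x - h a\<bar> < m" using e(2) by (simp add: dist_real_def)
    moreover have "min (e / 2) m \<le> m" by simp
    ultimately show "h x + min (e / 2) m < c" using m(2) by linarith
  qed
qed

text \<open>The margin \<open>\<kappa>\<close>, both in the argument and in the value, is what \<open>junction_inequality\<close> requires.\<close>

lemma quasi_convex_less_on_interval:
  assumes cont: "continuous_on UNIV h" and qc: "quasi_convex h" and ab: "h a < c" "h b < c"
  shows "\<exists>\<kappa>>0. \<forall>x. a - \<kappa> \<le> x \<longrightarrow> x \<le> b + \<kappa> \<longrightarrow> h x + \<kappa> < c"
proof -
  obtain \<kappa>1 where 1: "0 < \<kappa>1" "\<And>x. \<bar>x - a\<bar> \<le> \<kappa>1 \<Longrightarrow> h x + \<kappa>1 < c"
    using continuous_less_near[OF cont ab(1)] by blast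
  obtain \<kappa>2 where 2: "0 < \<kappa>2" "\<And>x. \<bar>x - b\<bar> \<le> \<kappa>2 \<Longrightarrow> h x + \<kappa>2 < c"
    using continuous_less_near[OF cont ab(2)] by blast
  define \<kappa> where "\<kappa> = min \<kappa>1 \<kappa>2"
  have \<kappa>: "0 < \<kappa>" "\<kappa> \<le> \<kappa>1" "\<kappa> \<le> \<kappa>2" using 1 2 by (simp_all add: \<kappa>_def)
  define m where "m = max (h (a - \<kappa>)) (h (b + \<kappa>))"
  have "h (a - \<kappa>) + \<kappa> < c" "h (b + \<kappa>) + \<kappa> < c"
    using 1(2)[of "a - \<kappa>"] 2(2)[of "b + \<kappa>"] \<kappa> by simp_all
  then have m: "m + \<kappa> < c" by (simp add: m_def)
  have "convex {x. h x \<le> m}" using qc by (simp add: quasi_convex_def)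
  then have interval: "is_interval {x. h x \<le> m}" by (simp add: is_interval_convex_1)
  have "h x + \<kappa> < c" if "a - \<kappa> \<le> x" "x \<le> b + \<kappa>" for x
    using mem_is_interval_1_I[OF interval _ _ that] m by (simp add: m_def)
  then show ?thesis using \<kappa>(1) by blast
qed

lemma nonincreasing_part_greater_on_ray:
  assumes cont: "continuous_on UNIV h" and tp: "turning_point h p0" and b: "c < nonincreasing_part h b"
  shows "\<exists>\<kappa>>0. \<forall>x\<le>b + \<kappa>. c + \<kappa> < h x"
proof -
  have "continuous_on UNIV (\<lambda>x. - h (min x p0))"
    by (intro continuous_intros continuous_on_compose2[OF cont]) auto
  moreover have "- h (min b p0) < - c" using b by (simp add: nonincreasing_part_min[OF tp])
  ultimately obtain \<kappa> where \<kappa>: "0 < \<kappa>" "\<And>x. \<bar>x - b\<bar> \<le> \<kappa> \<Longrightarrow> - h (min x p0) + \<kappa> < - c"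
    using continuous_less_near by blast
  have "c + \<kappa> < h x" if x: "x \<le> b + \<kappa>" for x
  proof -
    have "c + \<kappa> < h (min (b + \<kappa>) p0)" using \<kappa>(2)[of "b + \<kappa>"] \<kappa>(1) by simp
    also have "\<dots> \<le> h (min x p0)" using x by (intro turning_point_antimono[OF tp]) auto
    also have "\<dots> \<le> h x" using turning_point_mono[OF tp, of p0 x] by (simp add: min_def)
    finally show ?thesis .
  qed
  then show ?thesis using \<kappa>(1) by blast
qed

lemma greater_on_ray_above_turning_point:
  assumes cont: "continuous_on UNIV h" and tp: "turning_point h p0" and q: "p0 \<le> q" "c < h q"
  shows "\<exists>\<kappa>>0. \<forall>x\<ge>q - \<kappa>. c + \<kappa> < h x"
proof -
  have "continuous_on UNIV (\<lambda>x. - h x)" by (intro continuous_intros cont)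
  then obtain \<kappa> where \<kappa>: "0 < \<kappa>" "\<And>x. \<bar>x - q\<bar> \<le> \<kappa> \<Longrightarrow> - h x + \<kappa> < - c"
    using continuous_less_near[of "\<lambda>x. - h x" q "- c"] q(2) by auto
  have "c + \<kappa> < h x" if x: "q - \<kappa> \<le> x" for x
  proof (cases "x \<le> q")
    case True
    then show ?thesis using \<kappa>(2)[of x] x by simp
  next
    case False
    then have "h q \<le> h x" by (intro turning_point_mono[OF tp q(1)]) simp
    then show ?thesis using \<kappa>(2)[of q] \<kappa>(1) by simp
  qed
  then show ?thesis using \<kappa>(1) by blast
qed

lemma coercive_attains_above_turning_point:
  assumes cont: "continuous_on UNIV h" and coer: "coercive h" and c: "h p0 \<le> c"
  shows "\<exists>q\<ge>p0. h q = c"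
proof -
  have "eventually (\<lambda>p. c \<le> h p) at_infinity"
    using coer unfolding coercive_def filterlim_at_top by blast
  then obtain b where b: "\<And>p. b \<le> norm p \<Longrightarrow> c \<le> h p" unfolding eventually_at_infinity by blast
  define x where "x = max \<bar>b\<bar> p0"
  have "b \<le> norm x" "p0 \<le> x" by (auto simp: x_def)
  then have "c \<le> h x" using b by blast
  then have "\<exists>q\<ge>p0. q \<le> x \<and> h q = c"
    using c \<open>p0 \<le> x\<close> continuous_on_subset[OF cont] by (intro IVT') auto
  then show ?thesis by blast
qed


section \<open>The flux limiter\<close>

text \<open>The limiter is usually characterised by an equation \<open>F(q) = H\<^sub>i(q\<^sub>i) = A\<close> with \<open>q\<^sub>i\<close> on the nondecreasing
  part of \<open>H\<^sub>i\<close>. Solving it would need inverses of those parts, which jump where \<open>H\<^sub>i\<close> is flat, and a separate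
  treatment of \<open>A = max\<^sub>i min H\<^sub>i\<close>. The infimum of levels needs neither, and it provides just what the two
  halves of the proof use: \<open>effective_limiter_less\<close> for super-solutions and
  \<open>less_effective_limiter\<close> for sub-solutions.\<close>

definition effective_limiter ::
    "('n::finite \<Rightarrow> real \<Rightarrow> real) \<Rightarrow> (real ^ 'n \<Rightarrow> real) \<Rightarrow> ('n \<Rightarrow> real) \<Rightarrow> real"
  where "effective_limiter H F p0 = Inf {a. \<exists>q. (\<forall>i. p0 i \<le> q $ i \<and> H i (q $ i) < a) \<and> F q < a}"

lemma effective_limiter_less:
  assumes "effective_limiter H F p0 < l"
  obtains q where "\<And>i. p0 i \<le> q $ i" "\<And>i. H i (q $ i) < l" "F q < l"
proof -
  let ?S = "{a. \<exists>q. (\<forall>i. p0 i \<le> q $ i \<and> H i (q $ i) < a) \<and> F q < a}"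
  let ?q = "\<chi> i. p0 i"
  have "max (MAX i. H i (p0 i)) (F ?q) + 1 \<in> ?S"
  proof (rule CollectI, intro exI[of _ ?q] conjI allI)
    fix i
    show "p0 i \<le> ?q $ i" by simp
    have "H i (p0 i) \<le> (MAX i. H i (p0 i))" by (rule Max_ge) auto
    also have "\<dots> \<le> max (MAX i. H i (p0 i)) (F ?q)" by simp
    finally show "H i (?q $ i) < max (MAX i. H i (p0 i)) (F ?q) + 1" by simp
  qed simp
  then have "?S \<noteq> {}" by blast
  then obtain a where "a \<in> ?S" "a < l" using assms unfolding effective_limiter_def by (rule cInf_lessD[THEN bexE])
  then show ?thesis using that by (blast intro: less_trans)
qed

lemma less_effective_limiter:
  assumes tp: "\<And>i. turning_point (H i) (p0 i)" and l: "l < effective_limiter H F p0"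
    and q: "\<And>i. p0 i \<le> q $ i" "\<And>i. H i (q $ i) < l"
  shows "l \<le> F q"
proof (rule ccontr)
  let ?S = "{a. \<exists>q. (\<forall>i. p0 i \<le> q $ i \<and> H i (q $ i) < a) \<and> F q < a}"
  assume "\<not> l \<le> F q"
  then have "l \<in> ?S" using q by (auto intro!: exI[of _ q])
  moreover have "bdd_below ?S"
  proof (rule bdd_belowI)
    fix a assume "a \<in> ?S"
    then obtain q' where q': "\<And>i. p0 i \<le> q' $ i" "\<And>i. H i (q' $ i) < a" by blast
    \<comment> \<open>The minimum of any one of the Hamiltonians is a lower bound; which one does not matter.\<close>
    have "H undefined (p0 undefined) \<le> H undefined (q' $ undefined)"
      using turning_point_mono[OF tp order_refl q'(1)] .
    then show "H undefined (p0 undefined) \<le> a" using q'(2)[of undefined] by linarith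
  qed
  ultimately have "effective_limiter H F p0 \<le> l" unfolding effective_limiter_def by (rule cInf_lower)
  then show False using l by linarith
qed


section \<open>Relaxed solutions are flux-limited\<close>

lemma flux_limited_at_junction_super:
  fixes H :: "'n::finite \<Rightarrow> real \<Rightarrow> real"
  assumes cont: "\<And>i. continuous_on UNIV (H i)" and qc: "\<And>i. quasi_convex (H i)"
    and tp: "\<And>i. turning_point (H i) (p0 i)"
    and sup: "junction_supersolution H F T u" and u: "continuous_on (junction_T T) u"
    and \<phi>: "\<phi> \<in> test_functions T" and t0: "t0 \<in> {0<..<T}"
    and touch: "touches_from_below (junction_T T) \<phi> u (t0, 0)"
  shows "0 \<le> time_deriv \<phi> t0 0 + flux_limiter H (ereal (effective_limiter H F p0)) (junction_gradient \<phi> t0)"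
proof (rule ccontr)
  define l where "l = - time_deriv \<phi> t0 0"
  define p where "p = junction_gradient \<phi> t0"
  have p: "branch_deriv i \<phi> t0 0 = p $ i" for i by (simp add: p_def junction_gradient_def)
  assume "\<not> ?thesis"
  then have "flux_limiter H (ereal (effective_limiter H F p0)) p < l" by (simp add: l_def p_def)
  then have A: "effective_limiter H F p0 < l" and part: "\<And>i. nonincreasing_part (H i) (p $ i) < l"
    unfolding flux_limiter_less_iff by auto
  obtain q where q: "\<And>i. p0 i \<le> q $ i" "\<And>i. H i (q $ i) < l" "F q < l"
    using effective_limiter_less[OF A] by blast
  have "0 \<le> time_deriv \<phi> t0 0 + F (junction_gradient \<phi> t0 + (q - p)) \<or>
    (\<exists>i. 0 \<le> time_deriv \<phi> t0 0 + H i (branch_deriv i \<phi> t0 0 + (q - p) $ i))"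
  proof (rule junction_inequality[OF sup u \<phi> t0 touch])
    fix i assume less: "0 < (q - p) $ i"
    \<comment> \<open>On the nondecreasing side \<open>p $ i\<close> is controlled by \<open>q $ i\<close>, elsewhere by the flux-limited condition.\<close>
    have "H i (p $ i) < l"
    proof (cases "p $ i \<le> p0 i")
      case True
      then show ?thesis using part[of i] by (simp add: nonincreasing_part_eq[OF tp])
    next
      case False
      then have "H i (p $ i) \<le> H i (q $ i)" using less by (intro turning_point_mono[OF tp]) auto
      then show ?thesis using q(2)[of i] by linarith
    qed
    from quasi_convex_less_on_interval[OF cont qc this q(2)] obtain \<kappa> where
      \<kappa>: "0 < \<kappa>" "\<And>x. p $ i - \<kappa> \<le> x \<Longrightarrow> x \<le> q $ i + \<kappa> \<Longrightarrow> H i x + \<kappa> < l" by blast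
    have "time_deriv \<phi> t0 0 + \<kappa> + H i x < 0"
      if "branch_deriv i \<phi> t0 0 - \<kappa> \<le> x" "x \<le> branch_deriv i \<phi> t0 0 + (q - p) $ i + \<kappa>" for x
      using \<kappa>(2)[of x] that by (simp add: p l_def)
    then show "\<exists>\<kappa>>0. \<forall>x. branch_deriv i \<phi> t0 0 - \<kappa> \<le> x \<longrightarrow>
      x \<le> branch_deriv i \<phi> t0 0 + (q - p) $ i + \<kappa> \<longrightarrow> time_deriv \<phi> t0 0 + \<kappa> + H i x < 0"
      using \<kappa>(1) by blast
  qed
  then have "0 \<le> - l + F q \<or> (\<exists>i. 0 \<le> - l + H i (q $ i))"
    by (simp add: p_def[symmetric] p l_def)
  moreover have "- l + F q < 0" "- l + H i (q $ i) < 0" for i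
    using q(3) q(2)[of i] by linarith+
  ultimately show False by (meson not_le)
qed

text \<open>The statement about \<open>u\<close> is read off from \<open>- u\<close> and \<open>\<psi> = - \<phi>\<close>. All slopes change sign with them, so raising the
  slope of \<open>\<psi>\<close> from \<open>- p\<^sub>i\<close> to \<open>- q\<^sub>i\<close> amounts to lowering that of \<open>\<phi>\<close> from \<open>p\<^sub>i\<close> to \<open>q\<^sub>i\<close>.\<close>

lemma flux_limited_at_junction_sub:
  fixes H :: "'n::finite \<Rightarrow> real \<Rightarrow> real"
  assumes cont: "\<And>i. continuous_on UNIV (H i)" and coer: "\<And>i. coercive (H i)"
    and tp: "\<And>i. turning_point (H i) (p0 i)"
    and sup: "junction_supersolution (\<lambda>i p. - H i (- p)) (\<lambda>p. - F (- p)) T (\<lambda>z. - u z)"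
    and u: "continuous_on (junction_T T) u"
    and \<phi>: "\<phi> \<in> test_functions T" and t0: "t0 \<in> {0<..<T}"
    and touch: "touches_from_above (junction_T T) \<phi> u (t0, 0)"
  shows "time_deriv \<phi> t0 0 + flux_limiter H (ereal (effective_limiter H F p0)) (junction_gradient \<phi> t0) \<le> 0"
proof (rule ccontr)
  define l where "l = - time_deriv \<phi> t0 0"
  define p where "p = junction_gradient \<phi> t0"
  define \<psi> where "\<psi> = (\<lambda>z. - \<phi> z)"
  have \<psi>: "\<psi> \<in> test_functions T" unfolding \<psi>_def using \<phi> by (rule test_functions_minus)
  have deriv: "time_deriv \<psi> t0 0 = l" "branch_deriv i \<psi> t0 0 = - p $ i" for i
    using test_functions_minus(2,3)[OF \<phi> t0, of 0]
    by (simp_all add: \<psi>_def l_def p_def junction_gradient_def)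
  then have grad: "junction_gradient \<psi> t0 = - p" by (simp add: junction_gradient_def vec_eq_iff)
  have mu: "continuous_on (junction_T T) (\<lambda>z. - u z)" using u by (rule continuous_on_minus)
  have below: "touches_from_below (junction_T T) \<psi> (\<lambda>z. - u z) (t0, 0)"
    using touch by (simp add: \<psi>_def touches_from_above_minus[symmetric])
  assume "\<not> ?thesis"
  then have "l < flux_limiter H (ereal (effective_limiter H F p0)) p" by (simp add: l_def p_def)
  then consider i where "l < nonincreasing_part (H i) (p $ i)"
    | "l < effective_limiter H F p0" "\<And>i. nonincreasing_part (H i) (p $ i) \<le> l"
    unfolding less_flux_limiter_iff by (meson not_le)
  then show False
  proof cases
    case 1
    obtain \<kappa> where \<kappa>: "0 < \<kappa>" "\<And>x. x \<le> p $ i + \<kappa> \<Longrightarrow> l + \<kappa> < H i x"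
      using nonincreasing_part_greater_on_ray[OF cont tp 1] by blast
    obtain x where "branch_deriv i \<psi> t0 0 - \<kappa> < x" "0 \<le> time_deriv \<psi> t0 0 + \<kappa> + - H i (- x)"
      using steep_slope_allowed[OF sup mu \<psi> t0 below \<kappa>(1), of i] by blast
    then show False using \<kappa>(2)[of "- x"] unfolding deriv by simp
  next
    case 2
    \<comment> \<open>The gap between \<open>l\<close> and the limiter leaves room for \<open>q\<close> with \<open>l < H i (q $ i)\<close> although the values
    \<open>H i (q $ i)\<close> stay below a level that is itself below the limiter.\<close>
    obtain l' where l': "l < l'" "l' < effective_limiter H F p0" using dense[OF 2(1)] by blast
    have min_le: "H i (p0 i) \<le> l" for i
      using 2(2)[of i] turning_point_antimono[OF tp[of i], of "min (p $ i) (p0 i)" "p0 i"]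
      by (simp add: nonincreasing_part_min[OF tp])
    have "\<forall>i. \<exists>q\<ge>p0 i. H i q = (l + l') / 2"
    proof
      fix i
      have "H i (p0 i) \<le> (l + l') / 2" using min_le[of i] l'(1) by (simp add: field_simps)
      then show "\<exists>q\<ge>p0 i. H i q = (l + l') / 2"
        by (rule coercive_attains_above_turning_point[OF cont coer])
    qed
    from choice[OF this] obtain q0 where q0: "\<And>i. p0 i \<le> q0 i" "\<And>i. H i (q0 i) = (l + l') / 2" by blast
    define q where "q = (\<chi> i. q0 i)"
    have q: "p0 i \<le> q $ i" "l < H i (q $ i)" "H i (q $ i) < l'" for i
      using q0(1,2)[of i] l'(1) by (simp_all add: q_def field_simps)
    have Fq: "l' \<le> F q" using tp l'(2) q(1,3) by (rule less_effective_limiter)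
    have "0 \<le> time_deriv \<psi> t0 0 + - F (- (junction_gradient \<psi> t0 + (p - q))) \<or>
      (\<exists>i. 0 \<le> time_deriv \<psi> t0 0 + - H i (- (branch_deriv i \<psi> t0 0 + (p - q) $ i)))"
    proof (rule junction_inequality[OF sup mu \<psi> t0 below])
      fix i
      obtain \<kappa> where \<kappa>: "0 < \<kappa>" "\<And>x. q $ i - \<kappa> \<le> x \<Longrightarrow> l + \<kappa> < H i x"
        using greater_on_ray_above_turning_point[OF cont tp q(1,2)] by blast
      have "time_deriv \<psi> t0 0 + \<kappa> + - H i (- x) < 0"
        if "x \<le> branch_deriv i \<psi> t0 0 + (p - q) $ i + \<kappa>" for x
        using \<kappa>(2)[of "- x"] that unfolding deriv by simp
      then show "\<exists>\<kappa>>0. \<forall>x. branch_deriv i \<psi> t0 0 - \<kappa> \<le> x \<longrightarrow>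
        x \<le> branch_deriv i \<psi> t0 0 + (p - q) $ i + \<kappa> \<longrightarrow> time_deriv \<psi> t0 0 + \<kappa> + - H i (- x) < 0"
        using \<kappa>(1) by blast
    qed
    then have "0 \<le> l + - F q \<or> (\<exists>i. 0 \<le> l + - H i (q $ i))"
      by (simp add: deriv grad)
    moreover have "l + - F q < 0" "l + - H i (q $ i) < 0" for i
      using Fq l'(1) q(2)[of i] by linarith+
    ultimately show False by (meson not_le)
  qed
qed

theorem theorem1p1:
  fixes H :: "'n::finite \<Rightarrow> real \<Rightarrow> real" and F :: "real ^ 'n \<Rightarrow> real"
  assumes "\<And>i. continuous_on UNIV (H i)"
    and "\<And>i. quasi_convex (H i)"
    and "\<And>i. coercive (H i)"
    and "continuous_on UNIV F"
    and "\<And>p i. antimono (\<lambda>s. F (\<chi> j. if j = i then s else p $ j))"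
  shows "\<exists>A_F :: real. \<forall>T>0. \<forall>u :: real \<times> (real ^ 'n) \<Rightarrow> real.
    continuous_on ({0..<T} \<times> junction) u \<and> relaxed_solution H F T u
      \<longrightarrow> flux_limited_solution H (ereal A_F) T u"
proof -
  have "\<forall>i. \<exists>p. turning_point (H i) p" using turning_point_exists assms(1-3) by blast
  from choice[OF this] obtain p0 where tp: "\<And>i. turning_point (H i) (p0 i)" by blast
  have "flux_limited_solution H (ereal (effective_limiter H F p0)) T u"
    if u: "continuous_on ({0..<T} \<times> junction) u" and rel: "relaxed_solution H F T u"
    for T and u :: "real \<times> (real ^ 'n) \<Rightarrow> real"
  proof -
    have sub: "relaxed_subsolution H F T u" and super: "relaxed_supersolution H F T u"
      using rel by (simp_all add: relaxed_solution_def)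
    have u_T: "continuous_on (junction_T T) u" using u junction_T_subset by (rule continuous_on_subset)
    have above_iff: "touches_from_above (junction_T T) \<phi> (upper_envelope ({0..<T} \<times> junction) u) z
        \<longleftrightarrow> touches_from_above (junction_T T) \<phi> u z"
      and below_iff: "touches_from_below (junction_T T) \<phi> (lower_envelope ({0..<T} \<times> junction) u) z
        \<longleftrightarrow> touches_from_below (junction_T T) \<phi> u z"
      if "z \<in> junction_T T" for \<phi> z
      using envelope_eq[OF u] junction_T_subset that by (intro touches_cong; blast)+
    have "flux_limited_subsolution H (ereal (effective_limiter H F p0)) T u"
      unfolding flux_limited_subsolution_def
    proof (intro conjI ballI, goal_cases)
      case 1
      then show ?case using sub by (simp add: relaxed_subsolution_def)
    next
      case (2 \<phi> z)
      obtain t x where z: "z = (t, x)" by force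
      have t: "t \<in> {0<..<T}" using 2(2) by (simp add: z junction_T_def)
      have "time_deriv \<phi> t 0 + flux_limiter H (ereal (effective_limiter H F p0)) (junction_gradient \<phi> t) \<le> 0"
        if "touches_from_above (junction_T T) \<phi> u (t, x)" "x = 0"
        using that flux_limited_at_junction_sub[OF assms(1,3) tp
            relaxed_subsolution_junction[OF u sub] u_T 2(1) t] by simp
      moreover have "\<forall>i. x \<in> branch i - {0} \<longrightarrow> time_deriv \<phi> t x + H i (branch_deriv i \<phi> t x) \<le> 0"
        if "touches_from_above (junction_T T) \<phi> (upper_envelope ({0..<T} \<times> junction) u) (t, x)"
        using sub 2 that unfolding relaxed_subsolution_def z by fastforce
      ultimately show ?case using above_iff[OF 2(2)] unfolding z by auto
    qed
    moreover have "flux_limited_supersolution H (ereal (effective_limiter H F p0)) T u"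
      unfolding flux_limited_supersolution_def
    proof (intro conjI ballI, goal_cases)
      case 1
      then show ?case using super by (simp add: relaxed_supersolution_def)
    next
      case (2 \<phi> z)
      obtain t x where z: "z = (t, x)" by force
      have t: "t \<in> {0<..<T}" using 2(2) by (simp add: z junction_T_def)
      have "0 \<le> time_deriv \<phi> t 0 + flux_limiter H (ereal (effective_limiter H F p0)) (junction_gradient \<phi> t)"
        if "touches_from_below (junction_T T) \<phi> u (t, x)" "x = 0"
        using that flux_limited_at_junction_super[OF assms(1,2) tp
            relaxed_supersolution_junction[OF u super] u_T 2(1) t] by simp
      moreover have "\<forall>i. x \<in> branch i - {0} \<longrightarrow> 0 \<le> time_deriv \<phi> t x + H i (branch_deriv i \<phi> t x)"
        if "touches_from_below (junction_T T) \<phi> (lower_envelope ({0..<T} \<times> junction) u) (t, x)"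
        using super 2 that unfolding relaxed_supersolution_def z by fastforce
      ultimately show ?case using below_iff[OF 2(2)] unfolding z by auto
    qed
    ultimately show ?thesis by (simp add: flux_limited_solution_def)
  qed
  then show ?thesis by blast
qed

end
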